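(* Let $(\sigma,U)$ be an arbitrary finite-dimensional representation of $\mathfrak{sl}_2=\mathfrak{sl}_2(\mathbb{C})$. Then the graded Lie algebra $L(\mathfrak{sl}_2,\mathrm{f.d.})=\bigoplus_{n\in\mathbb{Z}}L_n$ (with $L_0\simeq\mathfrak{sl}_2$) has an $L_0$-submodule $W\subset L_1$ such that $(\sigma,U)\simeq(\operatorname{ad},W)$ as modules over $\mathfrak{sl}_2\simeq L_0$.
   Context: Everything is over $\mathbb{C}$. A graded Lie algebra is $\bigoplus_{n\in\mathbb{Z}}V_n$ with $[V_n,V_m]\subset V_{n+m}$, assumed generated by its local part $V_{-1}\oplus V_0\oplus V_1$. It is minimal if for every graded Lie algebra $\bigoplus_n V_n'$, every isomorphism of local parts $V'_{-1}\oplus V'_0\oplus V'_1\to V_{-1}\oplus V_0\oplus V_1$ extends to an epimorphism $\bigoplus_n V'_n\to\bigoplus_n V_n$. Let $\mathfrak{g}$ be a Lie algebra with a non-degenerate invariant bilinear form $B$, $\rho:\mathfrak{g}\otimes V\to V$ a representation, and $(\varrho,\mathcal{V})$ a $\mathfrak{g}$-submodule of $\operatorname{Hom}(V,\mathbb{C})$. The pentad $(\mathfrak{g},\rho,V,\mathcal{V},B)$ is standard if the canonical pairing restricted to $V\times\mathcal{V}$ is non-degenerate and there is a linear map $\Phi_\rho:V\otimes\mathcal{V}\to\mathfrak{g}$ with $B(a,\Phi_\rho(v\otimes\phi))=\langle\rho(a\otimes v),\phi\rangle=-\langle v,\varrho(a\otimes\phi)\rangle$ for all $a\in\mathfrak{g},v\in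 V,\phi\in\mathcal{V}$. The associated Lie algebra $L(\mathfrak{g},\rho,V,\mathcal{V},B)=\bigoplus_n V_n$ is the (unique) minimal graded Lie algebra with $V_0=\mathfrak{g}$, $V_1=V$, $V_{-1}=\mathcal{V}$ (as $\mathfrak{g}$-modules) and $[v,\phi]=\Phi_\rho(v\otimes\phi)$ for $v\in V_1,\phi\in V_{-1}$. For $n\ge 0$ let $(n\Lambda_1,V(n+1))$ be the $(n+1)$-dimensional irreducible representation of $\mathfrak{sl}_2$. Let $(\rho_{\mathrm{f.d.}},U_{\mathrm{f.d.}})$ be the direct sum over all $n\ge 0$ of countably infinitely many copies of $n\Lambda_1$. Since each $n\Lambda_1$ is self-dual, $U_{\mathrm{f.d.}}$ is regarded as a submodule of $\operatorname{Hom}(U_{\mathrm{f.d.}},\mathbb{C})$ via the pairing $U_{\mathrm{f.d.}}\times U_{\mathrm{f.d.}}\to\mathbb{C}$ which is a non-degenerate invariant pairing on each irreducible copy and for which distinct copies are orthogonal. With $K_{\mathfrak{sl}_2}$ the Killing form, $(\mathfrak{sl}_2,\rho_{\mathrm{f.d.}},U_{\mathrm{f.d.}},U_{\mathrm{f.d.}},K_{\mathfrak{sl}_2})$ is a standard pentad, and $L(\mathfrak{sl}_2,\mathrm{f.d.})=\bigoplus_{n\in\mathbb{Z}}L_n$ denotes the associated graded Lie algebra, so $L_0\simeq\mathfrak{sl}_2$ and $L_1\simeq L_{-1}\simeq U_{\mathrm{f.d.}}$ as $\mathfrak{sl}_2$-modules. *)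

theory Defs
  imports Complex_Main "Jordan_Normal_Form.VS_Connect"
begin

section \<open>Linear algebra over the complex numbers\<close>

abbreviation cfield :: "complex ring" where
  "cfield \<equiv> class_ring"

definition cline :: "(complex, complex) module" where
  "cline = \<lparr>carrier = UNIV, mult = (*), one = 1, zero = 0, add = (+), smult = (*)\<rparr>"

abbreviation linear_maps ::
    "(complex, 'v, 'm) module_scheme \<Rightarrow> (complex, 'w, 'n) module_scheme \<Rightarrow> ('v \<Rightarrow> 'w) set" where
  "linear_maps V W \<equiv> LinearCombinations.module_hom cfield V W"

text \<open>Linear maps out of a tensor product are rendered as bilinear maps.\<close>

definition bilinear_map ::
    "(complex, 'u, 'k) module_scheme \<Rightarrow> (complex, 'v, 'm) module_scheme \<Rightarrow>
     (complex, 'w, 'n) module_scheme \<Rightarrow> ('u \<Rightarrow> 'v \<Rightarrow> 'w) \<Rightarrow> bool" where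
  "bilinear_map U V W f \<longleftrightarrow>
     (\<forall>u\<in>carrier U. f u \<in> linear_maps V W) \<and>
     (\<forall>v\<in>carrier V. (\<lambda>u. f u v) \<in> linear_maps U W)"

definition nondegenerate_on :: "'u set \<Rightarrow> 'u \<Rightarrow> 'v set \<Rightarrow> 'v \<Rightarrow> ('u \<Rightarrow> 'v \<Rightarrow> complex) \<Rightarrow> bool" where
  "nondegenerate_on X zx Y zy f \<longleftrightarrow>
     (\<forall>x\<in>X. (\<forall>y\<in>Y. f x y = 0) \<longrightarrow> x = zx) \<and>
     (\<forall>y\<in>Y. (\<forall>x\<in>X. f x y = 0) \<longrightarrow> y = zy)"

text \<open>The trace of an endomorphism of a finite-dimensional space, as the sum of the diagonal
  matrix entries with respect to some basis.\<close>

definition endo_trace :: "(complex, 'v, 'm) module_scheme \<Rightarrow> ('v \<Rightarrow> 'v) \<Rightarrow> complex" where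
  "endo_trace V T =
     (let B = (SOME B. finite B \<and> vectorspace.basis cfield V B)
      in \<Sum>b\<in>B. (THE c. c \<in> extensional B \<and> T b = module.lincomb V c B) b)"

text \<open>The full dual space. Functionals are normalised to vanish outside the carrier, so that
  equality of functionals is equality on the carrier.\<close>

definition dual_space :: "(complex, 'v, 'm) module_scheme \<Rightarrow> (complex, 'v \<Rightarrow> complex) module" where
  "dual_space V =
     \<lparr>carrier = {\<phi> \<in> linear_maps V cline. \<forall>v. v \<notin> carrier V \<longrightarrow> \<phi> v = 0},
      mult = (\<lambda>_ _ _. 0), one = (\<lambda>_. 0), zero = (\<lambda>_. 0),
      add = (\<lambda>\<phi> \<psi> v. \<phi> v + \<psi> v), smult = (\<lambda>c \<phi> v. c * \<phi> v)\<rparr>"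


section \<open>Lie algebras and representations\<close>

record 'a lie = "(complex, 'a) module" +
  lbr :: "'a \<Rightarrow> 'a \<Rightarrow> 'a"

locale lie_algebra = vectorspace cfield L for L :: "('a, 'm) lie_scheme" +
  assumes lbr_bilinear: "bilinear_map L L L (lbr L)"
    and lbr_alternating: "x \<in> carrier L \<Longrightarrow> lbr L x x = \<zero>\<^bsub>L\<^esub>"
    and jacobi: "\<lbrakk>x \<in> carrier L; y \<in> carrier L; z \<in> carrier L\<rbrakk> \<Longrightarrow>
      lbr L x (lbr L y z) \<oplus>\<^bsub>L\<^esub> lbr L y (lbr L z x) \<oplus>\<^bsub>L\<^esub> lbr L z (lbr L x y) = \<zero>\<^bsub>L\<^esub>"

definition lie_subalgebra :: "('a, 'm) lie_scheme \<Rightarrow> 'a set \<Rightarrow> bool" where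
  "lie_subalgebra L S \<longleftrightarrow> VectorSpace.subspace cfield S L \<and> (\<forall>x\<in>S. \<forall>y\<in>S. lbr L x y \<in> S)"

definition lie_hom :: "('a, 'm) lie_scheme \<Rightarrow> ('b, 'n) lie_scheme \<Rightarrow> ('a \<Rightarrow> 'b) set" where
  "lie_hom L M = {f \<in> linear_maps L M.
     \<forall>x\<in>carrier L. \<forall>y\<in>carrier L. f (lbr L x y) = lbr M (f x) (f y)}"

locale lie_rep =
  alg: lie_algebra g + spc: vectorspace cfield V
  for g :: "('g, 'm) lie_scheme" and V :: "(complex, 'v, 'n) module_scheme" +
  fixes \<rho> :: "'g \<Rightarrow> 'v \<Rightarrow> 'v"
  assumes rep_bilinear: "bilinear_map g V V \<rho>"
    and rep_lbr: "\<lbrakk>x \<in> carrier g; y \<in> carrier g; v \<in> carrier V\<rbrakk> \<Longrightarrow>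
      \<rho> (lbr g x y) v = \<rho> x (\<rho> y v) \<ominus>\<^bsub>V\<^esub> \<rho> y (\<rho> x v)"

definition lie_submodule ::
    "('g, 'm) lie_scheme \<Rightarrow> (complex, 'v, 'n) module_scheme \<Rightarrow> ('g \<Rightarrow> 'v \<Rightarrow> 'v) \<Rightarrow> 'v set \<Rightarrow> bool" where
  "lie_submodule g V \<rho> W \<longleftrightarrow>
     VectorSpace.subspace cfield W V \<and> (\<forall>x\<in>carrier g. \<forall>w\<in>W. \<rho> x w \<in> W)"

definition rep_iso ::
    "('g, 'm) lie_scheme \<Rightarrow> (complex, 'v, 'n) module_scheme \<Rightarrow> ('g \<Rightarrow> 'v \<Rightarrow> 'v) \<Rightarrow>
     (complex, 'w, 'k) module_scheme \<Rightarrow> ('g \<Rightarrow> 'w \<Rightarrow> 'w) \<Rightarrow> ('v \<Rightarrow> 'w) \<Rightarrow> bool" where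
  "rep_iso g V \<rho> W \<tau> f \<longleftrightarrow>
     f \<in> linear_maps V W \<and> bij_betw f (carrier V) (carrier W) \<and>
     (\<forall>x\<in>carrier g. \<forall>v\<in>carrier V. f (\<rho> x v) = \<tau> x (f v))"

definition dual_action ::
    "(complex, 'v, 'n) module_scheme \<Rightarrow> ('g \<Rightarrow> 'v \<Rightarrow> 'v) \<Rightarrow> 'g \<Rightarrow> ('v \<Rightarrow> complex) \<Rightarrow> 'v \<Rightarrow> complex" where
  "dual_action V \<rho> x \<phi> = (\<lambda>v. if v \<in> carrier V then - \<phi> (\<rho> x v) else 0)"

definition killing_form :: "('a, 'm) lie_scheme \<Rightarrow> 'a \<Rightarrow> 'a \<Rightarrow> complex" where
  "killing_form g x y = endo_trace g (\<lambda>z. lbr g x (lbr g y z))"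

definition invariant_form :: "('a, 'm) lie_scheme \<Rightarrow> ('a \<Rightarrow> 'a \<Rightarrow> complex) \<Rightarrow> bool" where
  "invariant_form g B \<longleftrightarrow> bilinear_map g g cline B \<and>
     (\<forall>x\<in>carrier g. \<forall>y\<in>carrier g. \<forall>z\<in>carrier g. B (lbr g x y) z = B x (lbr g y z))"


section \<open>Graded Lie algebras\<close>

record 'a graded_lie = "'a lie" +
  grade :: "int \<Rightarrow> 'a set"

definition local_part :: "('a, 'm) graded_lie_scheme \<Rightarrow> 'a set" where
  "local_part L = {x \<oplus>\<^bsub>L\<^esub> y \<oplus>\<^bsub>L\<^esub> z | x y z. x \<in> grade L (-1) \<and> y \<in> grade L 0 \<and> z \<in> grade L 1}"

locale graded_lie_algebra = lie_algebra L for L :: "('a, 'm) graded_lie_scheme" +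
  assumes grade_subspace: "VectorSpace.subspace cfield (grade L n) L"
    and direct_sum: "x \<in> carrier L \<Longrightarrow>
      \<exists>!c. (\<forall>n. c n \<in> grade L n) \<and> finite {n. c n \<noteq> \<zero>\<^bsub>L\<^esub>} \<and>
           x = (\<Oplus>\<^bsub>L\<^esub>n\<in>{n. c n \<noteq> \<zero>\<^bsub>L\<^esub>}. c n)"
    and lbr_grade: "\<lbrakk>x \<in> grade L n; y \<in> grade L m\<rbrakk> \<Longrightarrow> lbr L x y \<in> grade L (n + m)"
    and generated_by_local_part: "\<lbrakk>lie_subalgebra L S; local_part L \<subseteq> S\<rbrakk> \<Longrightarrow> S = carrier L"

definition local_iso ::
    "('a, 'm) graded_lie_scheme \<Rightarrow> ('b, 'n) graded_lie_scheme \<Rightarrow> ('a \<Rightarrow> 'b) \<Rightarrow> bool" where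
  "local_iso L M \<psi> \<longleftrightarrow>
     \<psi> \<in> linear_maps (L\<lparr>carrier := local_part L\<rparr>) (M\<lparr>carrier := local_part M\<rparr>) \<and>
     bij_betw \<psi> (local_part L) (local_part M) \<and>
     (\<forall>i\<in>{-1, 0, 1}. \<psi> ` grade L i = grade M i) \<and>
     (\<forall>i\<in>{-1, 0, 1}. \<forall>j\<in>{-1, 0, 1}. i + j \<in> {-1, 0, 1} \<longrightarrow>
        (\<forall>x\<in>grade L i. \<forall>y\<in>grade L j. \<psi> (lbr L x y) = lbr M (\<psi> x) (\<psi> y)))"

definition graded_epi ::
    "('a, 'm) graded_lie_scheme \<Rightarrow> ('b, 'n) graded_lie_scheme \<Rightarrow> ('a \<Rightarrow> 'b) \<Rightarrow> bool" where
  "graded_epi L M \<pi> \<longleftrightarrow>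
     \<pi> \<in> lie_hom L M \<and> \<pi> ` carrier L = carrier M \<and> (\<forall>n. \<pi> ` grade L n \<subseteq> grade M n)"

text \<open>The competing graded Lie algebras range over all structures whose carrier is a subset of
  the type of \<open>M\<close>, with arbitrary operations. This loses no generality: a graded Lie algebra
  generated by a local part isomorphic to that of \<open>M\<close> is spanned by iterated brackets of elements
  of its local part, so its cardinality is at most that of the carrier of \<open>M\<close>, and it is isomorphic
  to a structure on a subset of this type.\<close>

definition minimal_graded :: "'a graded_lie \<Rightarrow> bool" where
  "minimal_graded M \<longleftrightarrow>
     (\<forall>(L :: 'a graded_lie) \<psi>. graded_lie_algebra L \<and> local_iso L M \<psi> \<longrightarrow>
        (\<exists>\<pi>. graded_epi L M \<pi> \<and> (\<forall>x\<in>local_part L. \<pi> x = \<psi> x)))"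


section \<open>Standard pentads and their Lie algebras\<close>

definition Phi_map ::
    "('g, 'm) lie_scheme \<Rightarrow> ('g \<Rightarrow> 'v \<Rightarrow> 'v) \<Rightarrow> (complex, 'v, 'n) module_scheme \<Rightarrow>
     ('v \<Rightarrow> complex) set \<Rightarrow> ('g \<Rightarrow> 'g \<Rightarrow> complex) \<Rightarrow> ('v \<Rightarrow> ('v \<Rightarrow> complex) \<Rightarrow> 'g) \<Rightarrow> bool" where
  "Phi_map g \<rho> V D B \<Phi> \<longleftrightarrow>
     bilinear_map V (dual_space V\<lparr>carrier := D\<rparr>) g \<Phi> \<and>
     (\<forall>a\<in>carrier g. \<forall>v\<in>carrier V. \<forall>\<phi>\<in>D.
        B a (\<Phi> v \<phi>) = \<phi> (\<rho> a v) \<and> \<phi> (\<rho> a v) = - dual_action V \<rho> a \<phi> v)"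

definition standard_pentad ::
    "('g, 'm) lie_scheme \<Rightarrow> ('g \<Rightarrow> 'v \<Rightarrow> 'v) \<Rightarrow> (complex, 'v, 'n) module_scheme \<Rightarrow>
     ('v \<Rightarrow> complex) set \<Rightarrow> ('g \<Rightarrow> 'g \<Rightarrow> complex) \<Rightarrow> bool" where
  "standard_pentad g \<rho> V D B \<longleftrightarrow>
     lie_rep g V \<rho> \<and>
     invariant_form g B \<and> nondegenerate_on (carrier g) \<zero>\<^bsub>g\<^esub> (carrier g) \<zero>\<^bsub>g\<^esub> B \<and>
     lie_submodule g (dual_space V) (dual_action V \<rho>) D \<and>
     nondegenerate_on (carrier V) \<zero>\<^bsub>V\<^esub> D (\<lambda>_. 0) (\<lambda>v \<phi>. \<phi> v) \<and>
     (\<exists>\<Phi>. Phi_map g \<rho> V D B \<Phi>)"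

text \<open>The Lie algebra associated with a standard pentad is determined up to isomorphism only;
  \<open>\<iota>0\<close>, \<open>\<iota>1\<close>, \<open>\<iota>m\<close> are the identifications of the Lie algebra, the representation space
  and the space of functionals with the components of degree 0, 1 and -1.\<close>

definition pentad_lie_algebra ::
    "('g, 'm) lie_scheme \<Rightarrow> ('g \<Rightarrow> 'v \<Rightarrow> 'v) \<Rightarrow> (complex, 'v, 'n) module_scheme \<Rightarrow>
     ('v \<Rightarrow> complex) set \<Rightarrow> ('g \<Rightarrow> 'g \<Rightarrow> complex) \<Rightarrow> 'a graded_lie \<Rightarrow>
     ('g \<Rightarrow> 'a) \<Rightarrow> ('v \<Rightarrow> 'a) \<Rightarrow> (('v \<Rightarrow> complex) \<Rightarrow> 'a) \<Rightarrow> bool" where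
  "pentad_lie_algebra g \<rho> V D B L \<iota>0 \<iota>1 \<iota>m \<longleftrightarrow>
     standard_pentad g \<rho> V D B \<and> graded_lie_algebra L \<and> minimal_graded L \<and>
     \<iota>0 \<in> lie_hom g (L\<lparr>carrier := grade L 0\<rparr>) \<and> bij_betw \<iota>0 (carrier g) (grade L 0) \<and>
     rep_iso g V \<rho> (L\<lparr>carrier := grade L 1\<rparr>) (\<lambda>a. lbr L (\<iota>0 a)) \<iota>1 \<and>
     rep_iso g (dual_space V\<lparr>carrier := D\<rparr>) (dual_action V \<rho>)
       (L\<lparr>carrier := grade L (-1)\<rparr>) (\<lambda>a. lbr L (\<iota>0 a)) \<iota>m \<and>
     (\<exists>\<Phi>. Phi_map g \<rho> V D B \<Phi> \<and>
        (\<forall>v\<in>carrier V. \<forall>\<phi>\<in>D. lbr L (\<iota>1 v) (\<iota>m \<phi>) = \<iota>0 (\<Phi> v \<phi>)))"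


section \<open>The Lie algebra sl(2) and its finite-dimensional representations\<close>

definition sl2 :: "complex mat lie" where
  "sl2 = \<lparr>carrier = {A \<in> carrier_mat 2 2. A $$ (0,0) + A $$ (1,1) = 0},
     mult = (*), one = 1\<^sub>m 2, zero = 0\<^sub>m 2 2, add = (+), smult = (\<cdot>\<^sub>m),
     lbr = (\<lambda>A B. A * B - B * A)\<rparr>"

definition sl2_irr :: "nat \<Rightarrow> (complex, nat \<Rightarrow> complex) module" where
  "sl2_irr n = \<lparr>carrier = {u. \<forall>j>n. u j = 0},
     mult = (\<lambda>_ _ _. 0), one = (\<lambda>_. 0), zero = (\<lambda>_. 0),
     add = (\<lambda>u v j. u j + v j), smult = (\<lambda>c u j. c * u j)\<rparr>"

text \<open>The action on binary forms of degree \<open>n\<close>, where \<open>u j\<close> is the coefficient of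
  \<open>x^(n-j) y^j\<close> and a matrix \<open>A\<close> acts as the derivation with \<open>A x = A00 x + A10 y\<close> and
  \<open>A y = A01 x + A11 y\<close>.\<close>

definition sl2_irr_action :: "nat \<Rightarrow> complex mat \<Rightarrow> (nat \<Rightarrow> complex) \<Rightarrow> nat \<Rightarrow> complex" where
  "sl2_irr_action n A u j =
     ((of_nat n - of_nat j) * A $$ (0,0) + of_nat j * A $$ (1,1)) * u j +
     (if j = 0 then 0 else (of_nat n - of_nat j + 1) * A $$ (1,0) * u (j - 1)) +
     (of_nat j + 1) * A $$ (0,1) * u (j + 1)"

text \<open>The direct sum, over all \<open>(n, k)\<close>, of the \<open>k\<close>-th copy of the irreducible
  representation of dimension \<open>n + 1\<close>.\<close>

definition U_fd :: "(complex, nat \<times> nat \<Rightarrow> nat \<Rightarrow> complex) module" where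
  "U_fd = \<lparr>carrier = {u. (\<forall>n k. u (n, k) \<in> carrier (sl2_irr n)) \<and> finite {m. u m \<noteq> (\<lambda>_. 0)}},
     mult = (\<lambda>_ _ _ _. 0), one = (\<lambda>_ _. 0), zero = (\<lambda>_ _. 0),
     add = (\<lambda>u v m j. u m j + v m j), smult = (\<lambda>c u m j. c * u m j)\<rparr>"

definition rho_fd ::
    "complex mat \<Rightarrow> (nat \<times> nat \<Rightarrow> nat \<Rightarrow> complex) \<Rightarrow> nat \<times> nat \<Rightarrow> nat \<Rightarrow> complex" where
  "rho_fd A u = (\<lambda>(n, k). sl2_irr_action n A (u (n, k)))"

definition copy_fd :: "nat \<times> nat \<Rightarrow> (nat \<times> nat \<Rightarrow> nat \<Rightarrow> complex) set" where
  "copy_fd m = {u \<in> carrier U_fd. \<forall>m'. m' \<noteq> m \<longrightarrow> u m' = (\<lambda>_. 0)}"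

definition fd_pairing ::
    "((nat \<times> nat \<Rightarrow> nat \<Rightarrow> complex) \<Rightarrow> (nat \<times> nat \<Rightarrow> nat \<Rightarrow> complex) \<Rightarrow> complex) \<Rightarrow> bool" where
  "fd_pairing P \<longleftrightarrow>
     bilinear_map U_fd U_fd cline P \<and>
     (\<forall>m. nondegenerate_on (copy_fd m) \<zero>\<^bsub>U_fd\<^esub> (copy_fd m) \<zero>\<^bsub>U_fd\<^esub> P \<and>
          (\<forall>A\<in>carrier sl2. \<forall>u\<in>copy_fd m. \<forall>w\<in>copy_fd m.
             P (rho_fd A u) w + P u (rho_fd A w) = 0)) \<and>
     (\<forall>m m'. m \<noteq> m' \<longrightarrow> (\<forall>u\<in>copy_fd m. \<forall>w\<in>copy_fd m'. P u w = 0))"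

definition U_fd_dual ::
    "((nat \<times> nat \<Rightarrow> nat \<Rightarrow> complex) \<Rightarrow> (nat \<times> nat \<Rightarrow> nat \<Rightarrow> complex) \<Rightarrow> complex) \<Rightarrow>
     ((nat \<times> nat \<Rightarrow> nat \<Rightarrow> complex) \<Rightarrow> complex) set" where
  "U_fd_dual P = {(\<lambda>u. if u \<in> carrier U_fd then P u w else 0) | w. w \<in> carrier U_fd}"

end

theory Submission
  imports Defs "HOL-Library.Function_Algebras"
begin

text \<open>
  Every finite-dimensional \<open>sl\<^sub>2\<close>-module \<open>U\<close> embeds into \<open>U\<^sub>f\<^sub>d \<simeq> L\<^sub>1\<close>. A functional \<open>\<mu>\<close> on \<open>U\<close> with
  \<open>\<mu> \<circ> f = 0\<close> and \<open>\<mu> \<circ> h = n \<mu>\<close> gives the equivariant map \<open>x \<mapsto> (\<mu> (e\<^sup>j x) / j!)\<^sub>j\<close> into the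
  irreducible module of dimension \<open>n + 1\<close>, and finitely many such maps separate the points of \<open>U\<close>.
  For if \<open>x \<noteq> 0\<close>, then, \<open>e\<close> being nilpotent, some \<open>y = e\<^sup>j x \<noteq> 0\<close> has \<open>e y = 0\<close>. Since
  \<open>ker e \<inter> im f = 0\<close>, a functional vanishing on \<open>im f\<close> does not vanish at \<open>y\<close>; it is annihilated by a
  product of distinct factors \<open>h - i\<close>, hence is a sum of eigenfunctionals \<open>\<mu>\<close> as above.
\<close>

section \<open>Linear dependence among more vectors than coordinates\<close>

text \<open>Gaussian elimination, one coordinate at a time. The vectors are a family over
  \<open>K\<close>, so that equal vectors, such as coinciding powers of an operator, count
  separately.\<close>

lemma ex_nontrivial_relation:
  fixes v :: "'k \<Rightarrow> 'i \<Rightarrow> 'a::field"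
  assumes "finite I" and "finite K" and "card I < card K"
  shows "\<exists>c. (\<exists>k\<in>K. c k \<noteq> 0) \<and> (\<forall>i\<in>I. (\<Sum>k\<in>K. c k * v k i) = 0)"
  using assms
proof (induction I arbitrary: K v)
  case empty
  then have "K \<noteq> {}" by auto
  then show ?case by (intro exI[of _ "\<lambda>_. 1"]) auto
next
  case (insert i I)
  show ?case
  proof (cases "\<forall>k\<in>K. v k i = 0")
    case True
    have "card I < card K" using insert.hyps insert.prems by simp
    then obtain c where "\<exists>k\<in>K. c k \<noteq> 0" "\<forall>i\<in>I. (\<Sum>k\<in>K. c k * v k i) = 0"
      using insert.IH[OF insert.prems(1)] by metis
    then show ?thesis using True by (intro exI[of _ c]) simp
  next
    case False
    then obtain p where p: "p \<in> K" "v p i \<noteq> 0" by blast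
    \<comment> \<open>The pivot \<open>p\<close> clears coordinate \<open>i\<close> from the other
      vectors; \<open>c'\<close> below gives \<open>p\<close> the coefficient that undoes the
      elimination.\<close>
    define w where "w = (\<lambda>k j. v k j - v k i / v p i * v p j)"
    have "card I < card (K - {p})" using insert.hyps insert.prems p(1) by simp
    then obtain c where c: "\<exists>k\<in>K - {p}. c k \<noteq> 0" "\<forall>j\<in>I. (\<Sum>k\<in>K - {p}. c k * w k j) = 0"
      using insert.IH[of "K - {p}" w] insert.prems(1) by auto
    define c' where "c' = c(p := - (\<Sum>k\<in>K - {p}. c k * (v k i / v p i)))"
    have "(\<Sum>k\<in>K. c' k * v k j) = (\<Sum>k\<in>K - {p}. c k * w k j)" for j
    proof -
      have "(\<Sum>k\<in>K. c' k * v k j) = c' p * v p j + (\<Sum>k\<in>K - {p}. c k * v k j)"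
        using insert.prems(1) p(1) by (simp add: sum.remove c'_def)
      then show ?thesis
        by (simp add: c'_def w_def right_diff_distrib sum_subtractf sum_distrib_right mult.assoc)
    qed
    moreover have "w k i = 0" for k using p(2) by (simp add: w_def)
    ultimately have "\<forall>j\<in>insert i I. (\<Sum>k\<in>K. c' k * v k j) = 0" using c(2) by simp
    moreover have "\<exists>k\<in>K. c' k \<noteq> 0" using c(1) by (auto simp: c'_def)
    ultimately show ?thesis by blast
  qed
qed

section \<open>Operators satisfying the \<open>sl2\<close> relations, and nilpotency of
  \<open>E\<close>\<close>

text \<open>The space is a whole type and may have infinite dimension: in the application it
  consists of all complex functions on the type of the vectors. Finiteness enters later through
  nilpotency of \<open>E\<close>.\<close>

locale sl2_triple = vector_space scale
  for scale :: "complex \<Rightarrow> 'v::ab_group_add \<Rightarrow> 'v" (infixr "*s" 75) +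
  fixes E F H :: "'v \<Rightarrow> 'v"
  assumes linear_E: "Vector_Spaces.linear (*s) (*s) E"
    and linear_F: "Vector_Spaces.linear (*s) (*s) F"
    and linear_H: "Vector_Spaces.linear (*s) (*s) H"
    and EF: "E (F x) = F (E x) + H x"
    and HE: "H (E x) = E (H x) + 2 *s E x"
    and HF: "H (F x) = F (H x) - 2 *s F x"
begin

sublocale E: Vector_Spaces.linear "(*s)" "(*s)" E by (rule linear_E)
sublocale F: Vector_Spaces.linear "(*s)" "(*s)" F by (rule linear_F)
sublocale H: Vector_Spaces.linear "(*s)" "(*s)" H by (rule linear_H)

lemmas op_simps = E.add E.diff E.scale F.add F.diff F.scale H.add H.diff H.scale

lemma E_pow_add: "(E ^^ k) (x + y) = (E ^^ k) x + (E ^^ k) y"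
  by (induction k) (simp_all add: op_simps)

lemma E_pow_diff: "(E ^^ k) (x - y) = (E ^^ k) x - (E ^^ k) y"
  by (induction k) (simp_all add: op_simps)

lemma E_pow_scale: "(E ^^ k) (c *s x) = c *s (E ^^ k) x"
  by (induction k) (simp_all add: op_simps)

lemma E_pow_zero: "(E ^^ k) 0 = 0"
  by (induction k) (simp_all add: op_simps)

lemma H_E_pow: "H ((E ^^ k) x) = (E ^^ k) (H x) + (2 * of_nat k) *s (E ^^ k) x"
proof (induction k)
  case 0
  show ?case by simp
next
  case (Suc k)
  have "2 * of_nat (Suc k) = 2 * of_nat k + (2 :: complex)" by simp
  then show ?case
    by (simp only: funpow.simps o_apply HE Suc E.add E.scale scale_left_distrib add.assoc)
qed

text \<open>The identity \<open>e^(k+1) f - f e^(k+1) = (k+1) e^k (h + k)\<close> of the enveloping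
  algebra.\<close>

lemma E_pow_F: "(E ^^ Suc k) (F x) = F ((E ^^ Suc k) x) + of_nat (Suc k) *s (E ^^ k) (H x + of_nat k *s x)"
proof (induction k)
  case 0
  show ?case by (simp add: EF)
next
  case (Suc k)
  have "(E ^^ Suc (Suc k)) (F x) = E ((E ^^ Suc k) (F x))" by simp
  also have "\<dots> = F ((E ^^ Suc (Suc k)) x) + H ((E ^^ Suc k) x)
      + of_nat (Suc k) *s (E ^^ Suc k) (H x + of_nat k *s x)"
    unfolding Suc by (simp add: op_simps EF)
  also have "\<dots> = F ((E ^^ Suc (Suc k)) x)
      + of_nat (Suc (Suc k)) *s (E ^^ Suc k) (H x + of_nat (Suc k) *s x)"
  proof -
    let ?P = "(E ^^ Suc k) (H x)" and ?R = "(E ^^ Suc k) x" and ?b = "of_nat (Suc k) :: complex"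
    have "(?P + (2 * ?b) *s ?R) + ?b *s (?P + of_nat k *s ?R)
        = (1 + ?b) *s ?P + (2 * ?b + ?b * of_nat k) *s ?R"
      by (simp only: scale_left_distrib scale_right_distrib scale_one scale_scale ac_simps)
    also have "\<dots> = of_nat (Suc (Suc k)) *s (?P + ?b *s ?R)"
    proof -
      have "1 + ?b = of_nat (Suc (Suc k))" "2 * ?b + ?b * of_nat k = of_nat (Suc (Suc k)) * ?b"
        by (simp_all add: algebra_simps)
      then show ?thesis by (simp only: scale_right_distrib scale_scale)
    qed
    finally show ?thesis by (simp only: H_E_pow E_pow_add E_pow_scale add.assoc)
  qed
  finally show ?case .
qed

text \<open>The automorphism that exchanges \<open>e\<close> and \<open>f\<close> and negates
  \<open>h\<close>. Through it, identities for powers of \<open>E\<close> yield identities for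
  powers of \<open>F\<close>.\<close>

lemma opposite: "sl2_triple (*s) F E (\<lambda>x. - H x)"
proof (unfold_locales, goal_cases)
  case (1 x y) show ?case by (simp add: op_simps)
next
  case (2 r x) show ?case by (simp add: op_simps)
next
  case (3 x) show ?case by (simp add: EF)
next
  case (4 x) show ?case by (simp add: HF F.neg)
next
  case (5 x) show ?case by (simp add: HE E.neg)
qed

text \<open>This is \<open>E_pow_F\<close> for the opposite triple, where the term
  \<open>F^(k+1) (E x)\<close> vanishes.\<close>

lemma E_F_pow_of_highest:
  assumes "E x = 0"
  shows "E ((F ^^ Suc k) x) = of_nat (Suc k) *s (F ^^ k) (H x - of_nat k *s x)"
proof -
  interpret op: sl2_triple "(*s)" F E "\<lambda>x. - H x" by (rule opposite)
  have "H x - of_nat k *s x = - (- H x + of_nat k *s x)" by simp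
  then have "of_nat (Suc k) *s (F ^^ k) (H x - of_nat k *s x)
      = - (of_nat (Suc k) *s (F ^^ k) (- H x + of_nat k *s x))"
    by (metis op.E_pow_diff op.E_pow_zero diff_0 scale_minus_right)
  moreover have "0 = E ((F ^^ Suc k) x) + of_nat (Suc k) *s (F ^^ k) (- H x + of_nat k *s x)"
    using op.E_pow_F[of k x] assms op.E_pow_zero by metis
  ultimately show ?thesis by (metis eq_neg_iff_add_eq_0)
qed

text \<open>Polynomials in \<open>H\<close> with prescribed roots. Annihilation by such a product
  replaces a decomposition into eigenspaces, so \<open>H\<close> is never shown to be
  diagonalisable.\<close>

primrec H_prod :: "(nat \<Rightarrow> complex) \<Rightarrow> nat \<Rightarrow> 'v \<Rightarrow> 'v" where
  "H_prod c 0 x = x"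
| "H_prod c (Suc k) x = H (H_prod c k x) - c k *s H_prod c k x"

lemma H_prod_diff: "H_prod c k (x - y) = H_prod c k x - H_prod c k y"
  by (induction k) (simp_all add: op_simps scale_right_diff_distrib)

lemma H_prod_add: "H_prod c k (x + y) = H_prod c k x + H_prod c k y"
  by (induction k) (simp_all add: op_simps scale_right_distrib)

lemma H_prod_scale: "H_prod c k (a *s x) = a *s H_prod c k x"
  by (induction k) (simp_all add: op_simps scale_right_diff_distrib mult.commute)

lemma H_prod_zero: "H_prod c k 0 = 0"
  by (induction k) (simp_all add: op_simps)

lemma H_prod_H: "H_prod c k (H x) = H (H_prod c k x)"
  by (induction k) (simp_all add: op_simps)

lemma H_prod_commute: "H_prod c k (H_prod d m x) = H_prod d m (H_prod c k x)"
  by (induction m) (simp_all add: H_prod_diff H_prod_scale H_prod_H)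

text \<open>\<open>F\<close> lowers eigenvalues of \<open>H\<close> by 2, so moving it across the
  product shifts every root by -2.\<close>

lemma F_H_prod: "F (H_prod c k x) = H_prod (\<lambda>i. c i - 2) k (F x)"
proof (induction k)
  case 0
  show ?case by simp
next
  case (Suc k)
  have "F (H (H_prod c k x)) = H (F (H_prod c k x)) + 2 *s F (H_prod c k x)"
    by (simp add: HF)
  then show ?case by (simp add: F.diff F.scale Suc scale_left_diff_distrib)
qed

lemma H_prod_eigenvector:
  assumes "H x = a *s x"
  shows "H_prod c k x = (\<Prod>i<k. a - c i) *s x"
proof (induction k)
  case (Suc k)
  have "H_prod c (Suc k) x = (\<Prod>i<k. a - c i) *s (a - c k) *s x"
    by (simp only: H_prod.simps Suc H.scale assms scale_left_diff_distrib scale_right_diff_distrib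
        scale_left_commute)
  then show ?case by simp
qed simp

lemma H_prod_coprime:
  assumes "H_prod c N x = 0" and "H_prod d M x = 0" and "\<And>i j. c i \<noteq> d j"
  shows "x = 0"
  using assms(1)
proof (induction N)
  case 0
  then show ?case by simp
next
  case (Suc N)
  let ?w = "H_prod c N x"
  have "H ?w = c N *s ?w" using Suc.prems by simp
  then have "(\<Prod>j<M. c N - d j) *s ?w = H_prod d M ?w" by (rule H_prod_eigenvector[symmetric])
  also have "\<dots> = 0"
    by (simp add: H_prod_commute[of d M c N x] assms(2) H_prod_zero)
  finally have "?w = 0" using assms(3) by simp
  then show ?case by (rule Suc.IH)
qed

text \<open>Cancelling one \<open>E\<close> against one \<open>F\<close> produces the factor
  \<open>(k+1) (H - k)\<close>. Since \<open>(H - k) x\<close> is again killed by \<open>E\<close>,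
  the induction runs over all such vectors. For a nilpotent \<open>E\<close> the left side vanishes
  at large \<open>k\<close>, which leaves a polynomial in \<open>H\<close> that kills
  \<open>x\<close>.\<close>

lemma E_pow_F_pow_of_highest:
  assumes "E x = 0"
  shows "(E ^^ k) ((F ^^ k) x) = fact k *s H_prod of_nat k x"
  using assms
proof (induction k arbitrary: x)
  case 0
  then show ?case by simp
next
  case (Suc k)
  let ?y = "H x - of_nat k *s x"
  have "E (H x) + 2 *s E x = 0" using HE[of x] Suc.prems by (simp add: op_simps)
  then have y: "E ?y = 0" using Suc.prems by (simp add: op_simps)
  have "(E ^^ Suc k) ((F ^^ Suc k) x) = (E ^^ k) (E ((F ^^ Suc k) x))"
    by (simp only: funpow_Suc_right o_apply)
  also have "\<dots> = of_nat (Suc k) *s (E ^^ k) ((F ^^ k) ?y)"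
    by (simp only: E_F_pow_of_highest[OF Suc.prems] E_pow_scale)
  also have "\<dots> = of_nat (Suc k) *s fact k *s H_prod of_nat k ?y"
    by (simp only: Suc.IH[OF y])
  also have "\<dots> = fact (Suc k) *s H_prod of_nat (Suc k) x"
    by (simp add: H_prod_diff H_prod_scale H_prod_H)
  finally show ?case .
qed

text \<open>Under the hypotheses for \<open>Suc m\<close>, \<open>E_pow_F\<close> reduces to
  \<open>(m+1) E^m (H + m) x = 0\<close>. So \<open>(H + m) x\<close> satisfies the hypotheses for
  \<open>m\<close>: each power of \<open>E\<close> is traded for one factor of the product.\<close>

lemma H_prod_of_E_F_zero:
  assumes "(E ^^ m) x = 0" and "E (F x) = 0"
  shows "H_prod (\<lambda>i. - of_nat i) m x = 0"
  using assms
proof (induction m arbitrary: x)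
  case 0
  then show ?case by simp
next
  case (Suc m)
  let ?y = "H x + of_nat m *s x"
  have "F (H x) = H (F x) + 2 *s F x" by (simp add: HF)
  moreover have "E (H (F x)) = 0"
    using HE[of "F x"] Suc.prems(2) by (simp add: op_simps)
  ultimately have y: "E (F ?y) = 0" using Suc.prems(2) by (simp add: op_simps)
  have "(E ^^ Suc m) (F x) = 0"
    using Suc.prems(2) by (simp only: funpow_Suc_right o_apply E_pow_zero)
  then have "of_nat (Suc m) *s (E ^^ m) ?y = 0"
    using E_pow_F[of m x] Suc.prems(1) by (simp only: F.zero add_0)
  then have "(E ^^ m) ?y = 0" by (simp del: of_nat_Suc)
  then have "H_prod (\<lambda>i. - of_nat i) m ?y = 0" using y by (rule Suc.IH)
  then show ?case by (simp add: H_prod_add H_prod_scale H_prod_H)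
qed

text \<open>A shortest nontrivial relation between powers of \<open>E\<close> has only one term: bracketing with \<open>H\<close>
  multiplies the coefficient of \<open>E\<^sup>k\<close> by \<open>2 k\<close>, so otherwise one term could be eliminated.\<close>

lemma nilpotent_of_relation:
  assumes "finite K" and "K \<noteq> {}" and "\<And>k. k \<in> K \<Longrightarrow> c k \<noteq> 0"
    and "\<And>x. (\<Sum>k\<in>K. c k *s (E ^^ k) x) = 0"
  shows "\<exists>N. \<forall>x. (E ^^ N) x = 0"
  using assms
proof (induction K arbitrary: c)
  case empty
  then show ?case by simp
next
  case (insert d K)
  show ?case
  proof (cases "K = {}")
    case True
    then have "(E ^^ d) x = 0" for x using insert.prems(2)[of d] insert.prems(3)[of x] by simp
    then show ?thesis by blast
  next
    case False
    define c' where "c' = (\<lambda>k. c k * (2 * of_nat k - 2 * of_nat d))"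
    show ?thesis
    proof (rule insert.IH[OF False])
      show "c' k \<noteq> 0" if "k \<in> K" for k
      proof -
        have "k \<noteq> d" using that insert.hyps(2) by auto
        then have "2 * of_nat k - 2 * of_nat d \<noteq> (0 :: complex)" by simp
        then show ?thesis using insert.prems(2)[of k] that by (simp add: c'_def)
      qed
      show "(\<Sum>k\<in>K. c' k *s (E ^^ k) x) = 0" for x
      proof -
        let ?K = "insert d K"
        have "0 = H (\<Sum>k\<in>?K. c k *s (E ^^ k) x)" by (simp only: insert.prems(3) H.zero)
        also have "\<dots> = (\<Sum>k\<in>?K. c k *s (E ^^ k) (H x) + (c k * (2 * of_nat k)) *s (E ^^ k) x)"
          by (simp only: H.sum H.scale H_E_pow scale_right_distrib scale_scale)
        \<comment> \<open>The relation holds at every vector, in particular at \<open>H x\<close>,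
          which removes the first summands.\<close>
        also have "\<dots> = (\<Sum>k\<in>?K. (c k * (2 * of_nat k)) *s (E ^^ k) x)"
          by (simp only: sum.distrib insert.prems(3) add_0)
        also have "\<dots> = (\<Sum>k\<in>?K. c' k *s (E ^^ k) x + (2 * of_nat d) *s c k *s (E ^^ k) x)"
        proof (rule sum.cong[OF refl])
          fix k
          have "c k * (2 * of_nat k) = c' k + 2 * of_nat d * c k" by (simp add: c'_def algebra_simps)
          then show "(c k * (2 * of_nat k)) *s (E ^^ k) x
              = c' k *s (E ^^ k) x + (2 * of_nat d) *s c k *s (E ^^ k) x"
            by (simp only: scale_left_distrib scale_scale)
        qed
        also have "\<dots> = (\<Sum>k\<in>?K. c' k *s (E ^^ k) x)"
          by (simp only: sum.distrib scale_sum_right[symmetric] insert.prems(3) scale_zero_right add_0_right)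
        also have "\<dots> = (\<Sum>k\<in>K. c' k *s (E ^^ k) x)"
          using insert.hyps by (simp add: c'_def)
        finally show ?thesis by simp
      qed
    qed
  qed
qed

lemma E_pow_relation_on_span:
  assumes "\<And>b. b \<in> B \<Longrightarrow> (\<Sum>k\<in>K. c k *s (E ^^ k) b) = 0" and "x \<in> span B"
  shows "(\<Sum>k\<in>K. c k *s (E ^^ k) x) = 0"
  using assms(2)
proof (induction rule: span_induct_alt)
  case base
  show ?case by (simp add: E_pow_zero)
next
  case (step a b y)
  have "(\<Sum>k\<in>K. c k *s (E ^^ k) (a *s b + y))
      = a *s (\<Sum>k\<in>K. c k *s (E ^^ k) b) + (\<Sum>k\<in>K. c k *s (E ^^ k) y)"
    by (simp only: E_pow_add E_pow_scale scale_right_distrib sum.distrib scale_sum_right scale_left_commute)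
  then show ?case using step assms(1) by simp
qed

text \<open>On \<open>B\<close> the powers of \<open>E\<close> are described by matrices indexed by
  \<open>B \<times> B\<close>, so \<open>card (B \<times> B) + 1\<close> of them are linearly
  dependent; \<open>nilpotent_of_relation\<close> then applies.\<close>

lemma nilpotent_of_finite_dim:
  assumes "finite B" and "\<And>x. E x \<in> span B"
  shows "\<exists>N. \<forall>x. (E ^^ N) x = 0"
proof -
  have "(E ^^ k) b \<in> span B" if "b \<in> B" for k b
    using that assms(2) by (cases k) (auto intro: span_base)
  then have "\<forall>k. \<forall>b\<in>B. \<exists>u. (E ^^ k) b = (\<Sum>a\<in>B. u a *s a)"
    unfolding span_finite[OF assms(1)] by blast
  then obtain m where m: "\<And>k b. b \<in> B \<Longrightarrow> (E ^^ k) b = (\<Sum>a\<in>B. m k b a *s a)"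
    by metis
  let ?K = "{..card (B \<times> B)}"
  obtain c where c: "\<exists>k\<in>?K. c k \<noteq> 0" "\<forall>(b, a)\<in>B \<times> B. (\<Sum>k\<in>?K. c k * m k b a) = 0"
    using ex_nontrivial_relation[of "B \<times> B" ?K "\<lambda>k (b, a). m k b a"] assms(1)
    by (auto simp del: card_cartesian_product)
  have base: "(\<Sum>k\<in>?K. c k *s (E ^^ k) b) = 0" if b: "b \<in> B" for b
  proof -
    have "(\<Sum>k\<in>?K. c k *s (E ^^ k) b) = (\<Sum>k\<in>?K. \<Sum>a\<in>B. (c k * m k b a) *s a)"
      by (simp only: m[OF b] scale_sum_right scale_scale)
    also have "\<dots> = (\<Sum>a\<in>B. \<Sum>k\<in>?K. (c k * m k b a) *s a)" by (rule sum.swap)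
    also have "\<dots> = (\<Sum>a\<in>B. (\<Sum>k\<in>?K. c k * m k b a) *s a)" by (simp only: scale_sum_left)
    also have "\<dots> = 0" using c(2) b by (intro sum.neutral) auto
    finally show ?thesis .
  qed
  define K where "K = {k \<in> ?K. c k \<noteq> 0}"
  \<comment> \<open>The relation found so far holds on \<open>span B\<close> only. Applying it to
    \<open>E x\<close>, which lies in this span, makes it valid for all \<open>x\<close> and raises
    each exponent by one.\<close>
  have rel: "(\<Sum>k\<in>Suc ` K. c (k - 1) *s (E ^^ k) x) = 0" for x
  proof -
    have "(\<Sum>k\<in>Suc ` K. c (k - 1) *s (E ^^ k) x) = (\<Sum>k\<in>K. c k *s (E ^^ k) (E x))"
      by (simp add: sum.reindex funpow_swap1)
    also have "\<dots> = (\<Sum>k\<in>?K. c k *s (E ^^ k) (E x))"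
      by (rule sum.mono_neutral_left) (auto simp: K_def)
    also have "\<dots> = 0" using E_pow_relation_on_span[OF base assms(2)] .
    finally show ?thesis .
  qed
  show ?thesis
    by (rule nilpotent_of_relation[of "Suc ` K" "\<lambda>k. c (k - 1)"]) (use c(1) rel in \<open>auto simp: K_def\<close>)
qed

end

section \<open>Nilpotent \<open>E\<close>: lowest weight functionals and separation of
  points\<close>

locale nilpotent_sl2_triple = sl2_triple +
  fixes N :: nat
  assumes nilpotent: "(E ^^ N) x = 0"
begin

text \<open>A vector in the kernel of \<open>E\<close> is annihilated by a product of factors \<open>H - i\<close>, a vector \<open>F a\<close>
  with \<open>E (F a) = 0\<close> by a product of factors \<open>H + i + 2\<close>, where \<open>i \<ge> 0\<close>.\<close>

lemma highest_in_range_F: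
  assumes "E (F a) = 0"
  shows "F a = 0"
proof (rule H_prod_coprime)
  show "H_prod of_nat N (F a) = 0"
    using E_pow_F_pow_of_highest[OF assms, of N] nilpotent by simp
  \<comment> \<open>The product with roots \<open>- i\<close> kills \<open>a\<close> itself. Passing
    to \<open>F a\<close> shifts the roots to \<open>- i - 2\<close>, so that they are all negative
    and the root 0 is no longer shared with the first product.\<close>
  show "H_prod (\<lambda>i. - of_nat i - 2) N (F a) = 0"
    using H_prod_of_E_F_zero[OF nilpotent assms] F_H_prod[of "\<lambda>i. - of_nat i" N a]
    by (simp add: op_simps)
  show "of_nat i \<noteq> (- of_nat j - 2 :: complex)" for i j
  proof
    assume "of_nat i = (- of_nat j - 2 :: complex)"
    then have "(of_nat (i + j + 2) :: complex) = 0" by simp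
    then show False unfolding of_nat_eq_0_iff by simp
  qed
qed

abbreviation functional :: "('a \<Rightarrow> complex) \<Rightarrow> bool" where
  "functional \<equiv> Vector_Spaces.linear (*s) (*)"

text \<open>In the dual module, where \<open>F\<close> acts by composition up to sign, these are the
  vectors killed by \<open>F\<close>.\<close>

definition lowest :: "('a \<Rightarrow> complex) \<Rightarrow> bool" where
  "lowest \<mu> \<longleftrightarrow> functional \<mu> \<and> (\<forall>x. \<mu> (F x) = 0)"

lemma lowestD:
  assumes "lowest \<mu>"
  shows "\<mu> (x + y) = \<mu> x + \<mu> y" "\<mu> (x - y) = \<mu> x - \<mu> y" "\<mu> (c *s x) = c * \<mu> x" "\<mu> 0 = 0" "\<mu> (F x) = 0"
proof -
  interpret \<mu>: Vector_Spaces.linear "(*s)" "(*)" \<mu> using assms by (simp add: lowest_def)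
  show "\<mu> (x + y) = \<mu> x + \<mu> y" "\<mu> (x - y) = \<mu> x - \<mu> y" "\<mu> (c *s x) = c * \<mu> x" "\<mu> 0 = 0"
    by (simp_all add: \<mu>.add \<mu>.diff \<mu>.scale \<mu>.zero)
  show "\<mu> (F x) = 0" using assms by (simp add: lowest_def)
qed

lemma lowestI:
  assumes "\<And>x y. \<mu> (x + y) = \<mu> x + \<mu> y" and "\<And>c x. \<mu> (c *s x) = c * \<mu> x" and "\<And>x. \<mu> (F x) = 0"
  shows "lowest \<mu>"
  unfolding lowest_def
proof
  show "functional \<mu>" by unfold_locales (simp_all add: assms algebra_simps)
qed (simp add: assms)

text \<open>Dual to \<open>E_pow_F_pow_of_highest\<close>. Moved to the left end, one
  \<open>F\<close> is killed by \<open>\<mu>\<close> and leaves the factor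
  \<open>(k+1) (H - k)\<close>. This factor is absorbed into the functional, which stays lowest;
  hence the induction is over all \<open>\<mu>\<close>.\<close>

lemma lowest_E_pow_F_pow:
  assumes "lowest \<mu>"
  shows "\<mu> ((E ^^ k) ((F ^^ k) x)) = fact k * \<mu> (H_prod of_nat k x)"
  using assms
proof (induction k arbitrary: \<mu>)
  case 0
  then show ?case by simp
next
  case (Suc k)
  note \<mu> = lowestD[OF Suc.prems]
  let ?\<nu> = "\<lambda>z. \<mu> (H z - of_nat k *s z)"
  have \<nu>: "lowest ?\<nu>"
  proof (rule lowestI)
    show "\<mu> (H (F z) - of_nat k *s F z) = 0" for z by (simp add: HF \<mu>)
  qed (simp_all add: op_simps \<mu> algebra_simps)
  let ?y = "(F ^^ k) x"
  have y: "(E ^^ k) (H ?y + of_nat k *s ?y) = H ((E ^^ k) ?y) - of_nat k *s (E ^^ k) ?y"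
    unfolding H_E_pow E_pow_add E_pow_scale mult_2 scale_left_distrib by (simp only: add.assoc[symmetric] add_diff_cancel)
  have "\<mu> ((E ^^ Suc k) ((F ^^ Suc k) x)) = \<mu> ((E ^^ Suc k) (F ?y))" by simp
  also have "\<dots> = of_nat (Suc k) * ?\<nu> ((E ^^ k) ?y)"
    by (simp only: E_pow_F \<mu> add_0 y)
  also have "\<dots> = of_nat (Suc k) * (fact k * ?\<nu> (H_prod of_nat k x))"
    by (simp only: Suc.IH[OF \<nu>])
  also have "\<dots> = fact (Suc k) * \<mu> (H_prod of_nat (Suc k) x)" by simp
  finally show ?case .
qed

lemma lowest_H_prod:
  assumes "lowest \<mu>"
  shows "\<mu> (H_prod of_nat N x) = 0"
proof -
  have "fact N * \<mu> (H_prod of_nat N x) = 0"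
    using lowest_E_pow_F_pow[OF assms, of N x] by (metis nilpotent lowestD(4)[OF assms])
  then show ?thesis by (metis fact_nonzero mult_eq_0_iff)
qed

lemma eigenfunctional_H_prod:
  assumes "lowest \<mu>" and "\<And>x. \<mu> (H x) = a * \<mu> x"
  shows "\<mu> (H_prod c k x) = (\<Prod>i<k. a - c i) * \<mu> x"
proof (induction k)
  case (Suc k)
  have "\<mu> (H_prod c (Suc k) x) = (a - c k) * \<mu> (H_prod c k x)"
    unfolding H_prod.simps lowestD(2,3)[OF assms(1)] assms(2) left_diff_distrib ..
  then show ?case unfolding Suc prod.lessThan_Suc by (simp only: mult.assoc mult.left_commute)
qed simp

text \<open>As a vector of the dual module \<open>\<mu>\<close> has weight \<open>- n\<close>;
  \<open>n\<close> becomes the degree of the binary forms receiving the associated map.\<close>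

definition lowest_weight :: "('a \<Rightarrow> complex) \<Rightarrow> nat \<Rightarrow> bool" where
  "lowest_weight \<mu> n \<longleftrightarrow> lowest \<mu> \<and> (\<forall>x. \<mu> (H x) = of_nat n * \<mu> x)"

text \<open>Eigenfunctionals are split off one root at a time. If \<open>\<mu>\<close> is killed by
  the factors \<open>H - i\<close> with \<open>i \<le> k\<close>, then composing it with those for
  \<open>i < k\<close> gives an eigenfunctional \<open>\<nu>\<close> for \<open>k\<close>. Either
  \<open>\<nu> y \<noteq> 0\<close>, or subtracting a multiple of \<open>\<nu>\<close> from
  \<open>\<mu>\<close> keeps the value at \<open>y\<close> and shortens the product.\<close>

lemma ex_lowest_weight:
  assumes "lowest \<mu>" and "\<mu> y \<noteq> 0"
  shows "\<exists>n \<nu>. lowest_weight \<nu> n \<and> \<nu> y \<noteq> 0"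
proof -
  have "\<exists>n \<nu>. lowest_weight \<nu> n \<and> \<nu> y \<noteq> 0"
    if "lowest \<mu>" "\<mu> y \<noteq> 0" "\<And>x. \<mu> (H_prod of_nat k x) = 0" for k \<mu>
    using that
  proof (induction k arbitrary: \<mu>)
    case 0
    then show ?case by simp
  next
    case (Suc k)
    note \<mu> = lowestD[OF Suc.prems(1)]
    define \<nu> where "\<nu> = (\<lambda>x. \<mu> (H_prod of_nat k x))"
    have low: "lowest \<nu>"
    proof (rule lowestI)
      \<comment> \<open>The roots \<open>i + 2\<close> are chosen so that moving \<open>F\<close>
        across the product turns them into \<open>i\<close>.\<close>
      show "\<nu> (F x) = 0" for x
        using F_H_prod[of "\<lambda>i. of_nat i + 2" k x] \<mu>(5)[of "H_prod (\<lambda>i. of_nat i + 2) k x"]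
        by (simp add: \<nu>_def)
    qed (simp_all add: \<nu>_def H_prod_add H_prod_scale \<mu>)
    have eig: "\<nu> (H x) = of_nat k * \<nu> x" for x
      using Suc.prems(3)[of x] by (simp add: \<nu>_def H_prod_H \<mu>)
    \<comment> \<open>The scalar by which the shorter product acts on \<open>\<nu>\<close>; it is
      nonzero because \<open>k\<close> is none of the roots \<open>0, ..., k - 1\<close>. Dividing
      by it makes the shorter product kill \<open>\<mu> - \<nu> / p\<close>.\<close>
    define p where "p = (\<Prod>i<k. of_nat k - of_nat i :: complex)"
    have p: "p \<noteq> 0" by (simp add: p_def)
    show ?case
    proof (cases "\<nu> y = 0")
      case False
      then show ?thesis using low eig by (auto simp: lowest_weight_def)
    next
      case True
      show ?thesis
      proof (rule Suc.IH)
        show "lowest (\<lambda>x. \<mu> x - \<nu> x / p)"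
          by (rule lowestI) (simp_all add: \<mu> lowestD[OF low] field_simps p)
        show "\<mu> y - \<nu> y / p \<noteq> 0" using True Suc.prems(2) by simp
        show "\<mu> (H_prod of_nat k x) - \<nu> (H_prod of_nat k x) / p = 0" for x
          using eigenfunctional_H_prod[OF low eig, of of_nat k x] p by (simp add: p_def[symmetric] fun_cong[OF \<nu>_def, symmetric])
      qed
    qed
  qed
  from this[OF assms lowest_H_prod[OF assms(1)]] show ?thesis .
qed

lemma lowest_weight_E_pow_H:
  assumes "lowest_weight \<mu> n"
  shows "\<mu> ((E ^^ j) (H x)) = (of_nat n - 2 * of_nat j) * \<mu> ((E ^^ j) x)"
proof -
  have low: "lowest \<mu>" using assms by (simp add: lowest_weight_def)
  have "\<mu> (H ((E ^^ j) x)) = of_nat n * \<mu> ((E ^^ j) x)" using assms by (simp add: lowest_weight_def)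
  then show ?thesis by (simp add: H_E_pow lowestD[OF low] algebra_simps)
qed

lemma lowest_weight_E_pow_F:
  assumes "lowest_weight \<mu> n"
  shows "\<mu> ((E ^^ Suc j) (F x)) = of_nat (Suc j) * (of_nat n - of_nat j) * \<mu> ((E ^^ j) x)"
proof -
  have low: "lowest \<mu>" using assms by (simp add: lowest_weight_def)
  show ?thesis
    by (simp only: E_pow_F lowestD[OF low] E_pow_add E_pow_scale lowest_weight_E_pow_H[OF assms])
      (simp add: algebra_simps)
qed

text \<open>The factor \<open>n - j\<close> of \<open>lowest_weight_E_pow_F\<close> vanishes at
  \<open>j = n\<close>, so \<open>\<mu>\<close> composed with \<open>E^(n+1)\<close> is again
  lowest. Its eigenvalue is \<open>n - 2 (n + 1) = - (n + 2)\<close>, which is not a root of the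
  product killing every lowest functional, so it is zero.\<close>

lemma lowest_weight_E_pow_eq_0:
  assumes "lowest_weight \<mu> n" and "n < j"
  shows "\<mu> ((E ^^ j) x) = 0"
proof -
  have low: "lowest \<mu>" using assms by (simp add: lowest_weight_def)
  let ?\<nu> = "\<lambda>x. \<mu> ((E ^^ Suc n) x)"
  have \<nu>: "lowest ?\<nu>"
  proof (rule lowestI)
    show "?\<nu> (F x) = 0" for x by (simp only: lowest_weight_E_pow_F[OF assms(1)]) simp
  qed (simp_all only: E_pow_add E_pow_scale lowestD[OF low])
  have "?\<nu> (H x) = - (of_nat n + 2) * ?\<nu> x" for x
    by (simp only: lowest_weight_E_pow_H[OF assms(1)]) (simp add: algebra_simps)
  then have "(\<Prod>i<N. - (of_nat n + 2) - of_nat i) * ?\<nu> x = 0" for x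
    using eigenfunctional_H_prod[OF \<nu>, of "- (of_nat n + 2)" of_nat N x] lowest_H_prod[OF \<nu>, of x] by simp
  moreover have "- (of_nat n + 2) - of_nat i \<noteq> (0::complex)" for i
  proof
    assume "- (of_nat n + 2) - of_nat i = (0::complex)"
    moreover have "(of_nat (n + 2 + i) :: complex) = - (- (of_nat n + 2) - of_nat i)" by simp
    ultimately have "(of_nat (n + 2 + i) :: complex) = 0" by simp
    then show False unfolding of_nat_eq_0_iff by simp
  qed
  ultimately have zero: "?\<nu> x = 0" for x by (metis mult_eq_0_iff finite_lessThan prod_zero_iff)
  obtain m where "j = Suc n + m" using assms(2) by (metis add_Suc less_iff_Suc_add)
  then have "(E ^^ j) x = (E ^^ Suc n) ((E ^^ m) x)" by (simp only: funpow_add o_apply)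
  then show ?thesis using zero by simp
qed

lemma ex_lowest_separating:
  assumes "x \<notin> range F"
  shows "\<exists>\<mu>. lowest \<mu> \<and> \<mu> x \<noteq> 0"
proof -
  interpret pair: vector_space_pair "(*s)" "(*) :: complex \<Rightarrow> _"
    by unfold_locales (simp_all add: algebra_simps)
  have sub: "subspace (range F)" by (rule F.subspace_image) (rule subspace_UNIV)
  obtain B where B: "B \<subseteq> range F" "independent B" "range F \<subseteq> span B"
    using basis_exists[of "range F"] by metis
  have "x \<notin> span B" using assms B(1) sub span_minimal by blast
  then have "independent (insert x B)" using B(2) by (simp add: independent_insertI)
  then obtain \<mu> where \<mu>: "functional \<mu>" "\<forall>b\<in>insert x B. \<mu> b = (if b = x then 1 else 0)"
    using pair.linear_independent_extend[of "insert x B" "\<lambda>b. if b = x then 1 else 0"] by blast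
  have "\<mu> b = 0" if "b \<in> B" for b
    using \<mu>(2) that assms B(1) by auto
  then have "\<mu> y = 0" if "y \<in> span B" for y
    using pair.linear_eq_0_on_span[OF \<mu>(1) _ that] by blast
  then have "\<mu> (F z) = 0" for z using B(3) by blast
  then show ?thesis using \<mu> by (auto simp: lowest_def intro!: exI[of _ \<mu>])
qed

lemma lowest_weight_separates:
  assumes "x \<noteq> 0"
  shows "\<exists>n \<mu> j. lowest_weight \<mu> n \<and> \<mu> ((E ^^ j) x) \<noteq> 0"
proof -
  define k where "k = (LEAST k. (E ^^ k) x = 0)"
  have k: "(E ^^ k) x = 0" unfolding k_def by (rule LeastI[of _ N]) (rule nilpotent)
  with assms obtain j where j: "k = Suc j" by (cases k) auto
  have nz: "(E ^^ j) x \<noteq> 0" using not_less_Least[of j "\<lambda>k. (E ^^ k) x = 0"] j k_def by simp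
  have "(E ^^ j) x \<notin> range F"
    using nz k j highest_in_range_F by auto
  then show ?thesis using ex_lowest_separating ex_lowest_weight by metis
qed

text \<open>Adding a generator enlarges the common kernel from 0 to dimension at most one, and a
  single further functional, nonzero on that line, suffices. A list is used because positions in it
  later number the copies in \<open>U_fd\<close>.\<close>

lemma finite_separating_family:
  assumes "finite B"
  shows "\<exists>T. (\<forall>(\<mu>, n)\<in>set T. lowest_weight \<mu> n) \<and>
    (\<forall>x\<in>span B. (\<forall>(\<mu>, n)\<in>set T. \<forall>j. \<mu> ((E ^^ j) x) = 0) \<longrightarrow> x = 0)"
  using assms
proof induction
  case empty
  show ?case by (rule exI[of _ "[]"]) simp
next
  case (insert b B)
  then obtain T where T: "\<forall>(\<mu>, n)\<in>set T. lowest_weight \<mu> n"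
    "\<And>x. x \<in> span B \<Longrightarrow> \<forall>(\<mu>, n)\<in>set T. \<forall>j. \<mu> ((E ^^ j) x) = 0 \<Longrightarrow> x = 0"
    by metis
  let ?K = "{x \<in> span (insert b B). \<forall>(\<mu>, n)\<in>set T. \<forall>j. \<mu> ((E ^^ j) x) = 0}"
  show ?case
  proof (cases "?K \<subseteq> {0}")
    case True
    then show ?thesis using T(1) by (intro exI[of _ T]) blast
  next
    case False
    then obtain x where x: "x \<in> ?K" "x \<noteq> 0" by blast
    obtain \<mu> n j where sep: "lowest_weight \<mu> n" "\<mu> ((E ^^ j) x) \<noteq> 0"
      using lowest_weight_separates[OF x(2)] by metis
    have low: "lowest \<mu>" using sep(1) by (simp add: lowest_weight_def)
    obtain c where c: "x - c *s b \<in> span B" using x(1) span_breakdown_eq by blast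
    have "c \<noteq> 0" using T(2)[of x] c x by auto
    have "y = 0" if y: "y \<in> ?K" "\<forall>j. \<mu> ((E ^^ j) y) = 0" for y
    proof -
      obtain d where d: "y - d *s b \<in> span B" using y(1) span_breakdown_eq by blast
      \<comment> \<open>This combination eliminates \<open>b\<close>, so it lies in
        \<open>span B\<close> and in the kernel of the old family; hence it is 0 and
        \<open>y\<close> is proportional to \<open>x\<close>.\<close>
      let ?z = "c *s y - d *s x"
      have "?z = c *s (y - d *s b) - d *s (x - c *s b)"
        by (simp add: scale_right_diff_distrib mult.commute)
      then have "?z \<in> span B" using c d by (simp add: span_diff span_scale)
      moreover have "\<nu> ((E ^^ j) ?z) = 0" if "(\<nu>, m) \<in> set T" for \<nu> m j
      proof -
        have "lowest \<nu>" using T(1) that by (auto simp: lowest_weight_def)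
        then show ?thesis using x(1) y(1) that by (fastforce simp: E_pow_diff E_pow_scale lowestD)
      qed
      ultimately have "?z = 0" using T(2)[of ?z] by blast
      then have eq: "c *s y = d *s x" by simp
      then have "\<mu> ((E ^^ j) (c *s y)) = d * \<mu> ((E ^^ j) x)" by (simp add: E_pow_scale lowestD[OF low])
      then have "d = 0" using y(2) sep(2) by (simp add: E_pow_scale lowestD[OF low])
      then show "y = 0" using eq \<open>c \<noteq> 0\<close> by simp
    qed
    then show ?thesis using T(1) sep(1) by (intro exI[of _ "(\<mu>, n) # T"]) fastforce
  qed
qed

end


section \<open>Coordinates of a finite-dimensional space as functions\<close>

abbreviation (input) fscale :: "complex \<Rightarrow> ('i \<Rightarrow> complex) \<Rightarrow> 'i \<Rightarrow> complex" where
  "fscale c u \<equiv> \<lambda>i. c * u i"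

lemma vector_space_fscale: "vector_space fscale"
  by unfold_locales (auto simp: fun_eq_iff algebra_simps)

lemma fscale_support_in_span:
  assumes "finite B" and "\<And>b. b \<notin> B \<Longrightarrow> u b = 0"
  shows "u \<in> module.span fscale ((\<lambda>b i. if i = b then 1 else 0) ` B)"
proof -
  interpret vector_space fscale by (rule vector_space_fscale)
  have "u = (\<Sum>b\<in>B. fscale (u b) (\<lambda>i. if i = b then 1 else 0))"
  proof
    fix i
    have "(\<Sum>b\<in>B. fscale (u b) (\<lambda>i. if i = b then 1 else 0)) i = (\<Sum>b\<in>B. u b * (if i = b then 1 else 0))"
      using assms(1) by (induction B) auto
    also have "\<dots> = u i" using assms by (simp add: if_distrib cong: if_cong)
    finally show "u i = (\<Sum>b\<in>B. fscale (u b) (\<lambda>i. if i = b then 1 else 0)) i" by simp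
  qed
  moreover have "(\<Sum>b\<in>B. fscale (u b) (\<lambda>i. if i = b then 1 else 0))
      \<in> span ((\<lambda>b i. if i = b then 1 else 0) ` B)"
    by (intro span_sum span_scale span_base) auto
  ultimately show ?thesis by simp
qed

text \<open>Passes from a carrier set to a whole type, where the operator results above apply. The
  coordinate map \<open>\<psi>\<close> pads with 0 outside the basis, while \<open>r\<close> accepts
  every function and ignores its values there; thus \<open>r\<close> is a left inverse of
  \<open>\<psi>\<close>.\<close>

lemma ex_coordinates:
  fixes V :: "(complex, 'v, 'm) module_scheme"
  assumes "vectorspace cfield V" and "vectorspace.fin_dim cfield V"
  obtains B and \<psi> :: "'v \<Rightarrow> 'v \<Rightarrow> complex" and r where "finite B"
    and "\<And>x. x \<in> carrier V \<Longrightarrow> r (\<psi> x) = x"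
    and "\<And>x b. x \<in> carrier V \<Longrightarrow> b \<notin> B \<Longrightarrow> \<psi> x b = 0"
    and "\<And>x y. x \<in> carrier V \<Longrightarrow> y \<in> carrier V \<Longrightarrow> \<psi> (x \<oplus>\<^bsub>V\<^esub> y) = \<psi> x + \<psi> y"
    and "\<And>c x. x \<in> carrier V \<Longrightarrow> \<psi> (c \<odot>\<^bsub>V\<^esub> x) = fscale c (\<psi> x)"
    and "\<And>u. r u \<in> carrier V"
    and "\<And>u v. r (u + v) = r u \<oplus>\<^bsub>V\<^esub> r v"
    and "\<And>c u. r (fscale c u) = c \<odot>\<^bsub>V\<^esub> r u"
proof -
  interpret V: vectorspace cfield V by (rule assms(1))
  obtain B where B: "finite B" "V.basis B" using V.finite_basis_exists[OF assms(2)] by blast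
  have BV: "B \<subseteq> carrier V" using B(2) by (simp add: V.basis_def)
  define r where "r = (\<lambda>u. V.lincomb u B)"
  have r_closed: "r u \<in> carrier V" for u
    using BV by (simp add: r_def V.lincomb_closed)
  have r_add: "r (u + v) = r u \<oplus>\<^bsub>V\<^esub> r v" for u v
    using V.lincomb_sum[OF B(1) BV, of u v] by (simp add: r_def plus_fun_def)
  have r_scale: "r (fscale c u) = c \<odot>\<^bsub>V\<^esub> r u" for c u
    using V.lincomb_smult[OF BV, of u c] by (simp add: r_def)
  have r_cong: "r u = r v" if "\<And>b. b \<in> B \<Longrightarrow> u b = v b" for u v
    unfolding r_def using that BV by (intro V.lincomb_cong) auto
  have ex1: "\<exists>!a. a \<in> B \<rightarrow>\<^sub>E UNIV \<and> r a = x" if "x \<in> carrier V" for x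
    using iffD1[OF V.basis_criterion[OF B(1) BV] B(2)] that by (simp add: r_def)
  have unique: "u = v" if "r u = r v" "\<And>b. b \<notin> B \<Longrightarrow> u b = 0" "\<And>b. b \<notin> B \<Longrightarrow> v b = 0" for u v
  proof -
    \<comment> \<open>The basis criterion gives uniqueness among extensional functions, which are
      \<open>undefined\<close> rather than 0 outside \<open>B\<close>, so both functions are
      restricted first.\<close>
    have "r (restrict u B) = r u" "r (restrict v B) = r v" by (auto intro: r_cong)
    then have "restrict u B = restrict v B"
      using ex1[OF r_closed[of u]] that(1) by (metis PiE_UNIV_domain restrict_PiE_iff UNIV_I)
    then show ?thesis using that(2,3) by (metis ext restrict_apply')
  qed
  have "\<exists>u. r u = x \<and> (\<forall>b. b \<notin> B \<longrightarrow> u b = 0)" if x: "x \<in> carrier V" for x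
  proof -
    obtain a where "r a = x" using ex1[OF x] by blast
    then have "r (\<lambda>b. if b \<in> B then a b else 0) = x" using r_cong[of "\<lambda>b. if b \<in> B then a b else 0" a] by simp
    then show ?thesis by (intro exI[of _ "\<lambda>b. if b \<in> B then a b else 0"]) simp
  qed
  then obtain \<psi> where \<psi>: "\<And>x. x \<in> carrier V \<Longrightarrow> r (\<psi> x) = x"
    "\<And>x b. x \<in> carrier V \<Longrightarrow> b \<notin> B \<Longrightarrow> \<psi> x b = 0"
    by metis
  have \<psi>_add: "\<psi> (x \<oplus>\<^bsub>V\<^esub> y) = \<psi> x + \<psi> y" if "x \<in> carrier V" "y \<in> carrier V" for x y
    by (rule unique) (use that in \<open>simp_all add: \<psi> r_add\<close>)
  have \<psi>_scale: "\<psi> (c \<odot>\<^bsub>V\<^esub> x) = fscale c (\<psi> x)" if "x \<in> carrier V" for c x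
    by (rule unique) (use that in \<open>simp_all add: \<psi> r_scale\<close>)
  show thesis by (rule that[OF B(1) \<psi> \<psi>_add \<psi>_scale r_closed r_add r_scale])
qed


section \<open>The standard basis of \<open>sl2\<close>\<close>

definition sl2_e :: "complex mat" where
  "sl2_e = mat 2 2 (\<lambda>(i, j). if i = 0 \<and> j = 1 then 1 else 0)"

definition sl2_f :: "complex mat" where
  "sl2_f = mat 2 2 (\<lambda>(i, j). if i = 1 \<and> j = 0 then 1 else 0)"

definition sl2_h :: "complex mat" where
  "sl2_h = mat 2 2 (\<lambda>(i, j). if i \<noteq> j then 0 else if i = 0 then 1 else - 1)"

lemma sl2_simps:
  "carrier sl2 = {A \<in> carrier_mat 2 2. A $$ (0,0) + A $$ (1,1) = 0}"
  "\<zero>\<^bsub>sl2\<^esub> = 0\<^sub>m 2 2" "x \<oplus>\<^bsub>sl2\<^esub> y = x + y" "c \<odot>\<^bsub>sl2\<^esub> x = c \<cdot>\<^sub>m x" "lbr sl2 x y = x * y - y * x"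
  by (simp_all add: sl2_def)

lemma less_two_cases: "(i :: nat) < 2 \<longleftrightarrow> i = 0 \<or> i = 1"
  by auto

lemma sl2_basis_closed:
  "sl2_e \<in> carrier sl2" "sl2_f \<in> carrier sl2" "sl2_h \<in> carrier sl2"
  by (simp_all add: sl2_simps sl2_e_def sl2_f_def sl2_h_def)

lemmas sl2_matrix_simps = sl2_simps sl2_e_def sl2_f_def sl2_h_def less_two_cases scalar_prod_def
  numeral_2_eq_2

lemma sl2_bracket_e_f: "lbr sl2 sl2_e sl2_f = sl2_h"
  by (rule eq_matI) (auto simp: sl2_matrix_simps less_Suc_eq)

lemma sl2_bracket_h_e: "lbr sl2 sl2_h sl2_e = 2 \<odot>\<^bsub>sl2\<^esub> sl2_e"
  by (rule eq_matI) (auto simp: sl2_matrix_simps less_Suc_eq)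

lemma sl2_bracket_h_f: "lbr sl2 sl2_h sl2_f = (- 2) \<odot>\<^bsub>sl2\<^esub> sl2_f"
  by (rule eq_matI) (auto simp: sl2_matrix_simps less_Suc_eq)

lemma sl2_decomposition:
  assumes "A \<in> carrier sl2"
  shows "A = (A $$ (0,0) \<odot>\<^bsub>sl2\<^esub> sl2_h \<oplus>\<^bsub>sl2\<^esub> A $$ (0,1) \<odot>\<^bsub>sl2\<^esub> sl2_e) \<oplus>\<^bsub>sl2\<^esub> A $$ (1,0) \<odot>\<^bsub>sl2\<^esub> sl2_f"
proof -
  have "A \<in> carrier_mat 2 2" "A $$ (1,1) = - A $$ (0,0)"
    using assms by (simp_all add: sl2_simps eq_neg_iff_add_eq_0 add.commute)
  then show ?thesis
    by (intro eq_matI) (auto simp: sl2_simps sl2_e_def sl2_f_def sl2_h_def less_two_cases)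
qed

section \<open>Embedding a finite-dimensional module into \<open>U_fd\<close>\<close>

lemma U_fd_embedding_exists:
  fixes U :: "(complex, 'u, 'm) module_scheme"
  assumes rep: "lie_rep sl2 U \<sigma>" and fin: "vectorspace.fin_dim cfield U"
  shows "\<exists>\<theta> \<in> linear_maps U U_fd. inj_on \<theta> (carrier U) \<and>
    (\<forall>A\<in>carrier sl2. \<forall>x\<in>carrier U. \<theta> (\<sigma> A x) = rho_fd A (\<theta> x))"
proof -
  interpret rep: lie_rep sl2 U \<sigma> by (rule rep)
  obtain B and \<psi> :: "'u \<Rightarrow> 'u \<Rightarrow> complex" and r where B: "finite B"
    and r_\<psi>: "\<And>x. x \<in> carrier U \<Longrightarrow> r (\<psi> x) = x"
    and supp: "\<And>x b. x \<in> carrier U \<Longrightarrow> b \<notin> B \<Longrightarrow> \<psi> x b = 0"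
    and \<psi>_add: "\<And>x y. x \<in> carrier U \<Longrightarrow> y \<in> carrier U \<Longrightarrow> \<psi> (x \<oplus>\<^bsub>U\<^esub> y) = \<psi> x + \<psi> y"
    and \<psi>_scale: "\<And>c x. x \<in> carrier U \<Longrightarrow> \<psi> (c \<odot>\<^bsub>U\<^esub> x) = fscale c (\<psi> x)"
    and r_closed: "\<And>u. r u \<in> carrier U"
    and r_add: "\<And>u v. r (u + v) = r u \<oplus>\<^bsub>U\<^esub> r v"
    and r_scale: "\<And>c u. r (fscale c u) = c \<odot>\<^bsub>U\<^esub> r u"
    by (rule ex_coordinates[OF rep.spc.vectorspace_axioms fin]) (rule that)
  have \<sigma>_closed: "\<sigma> A x \<in> carrier U" if "A \<in> carrier sl2" "x \<in> carrier U" for A x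
    using rep.rep_bilinear that unfolding bilinear_map_def LinearCombinations.module_hom_def by blast
  have \<sigma>_add: "\<sigma> A (x \<oplus>\<^bsub>U\<^esub> y) = \<sigma> A x \<oplus>\<^bsub>U\<^esub> \<sigma> A y"
    if "A \<in> carrier sl2" "x \<in> carrier U" "y \<in> carrier U" for A x y
    using rep.rep_bilinear that unfolding bilinear_map_def LinearCombinations.module_hom_def by blast
  have \<sigma>_scale: "\<sigma> A (c \<odot>\<^bsub>U\<^esub> x) = c \<odot>\<^bsub>U\<^esub> \<sigma> A x" if "A \<in> carrier sl2" "x \<in> carrier U" for A x c
    using rep.rep_bilinear that unfolding bilinear_map_def LinearCombinations.module_hom_def by simp
  have \<sigma>_add_left: "\<sigma> (A \<oplus>\<^bsub>sl2\<^esub> A') x = \<sigma> A x \<oplus>\<^bsub>U\<^esub> \<sigma> A' x"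
    if "A \<in> carrier sl2" "A' \<in> carrier sl2" "x \<in> carrier U" for A A' x
    using rep.rep_bilinear that unfolding bilinear_map_def LinearCombinations.module_hom_def by blast
  have \<sigma>_scale_left: "\<sigma> (c \<odot>\<^bsub>sl2\<^esub> A) x = c \<odot>\<^bsub>U\<^esub> \<sigma> A x" if "A \<in> carrier sl2" "x \<in> carrier U" for A x c
    using rep.rep_bilinear that unfolding bilinear_map_def LinearCombinations.module_hom_def by simp
  have \<psi>_minus: "\<psi> (x \<ominus>\<^bsub>U\<^esub> y) = \<psi> x - \<psi> y" if xy: "x \<in> carrier U" "y \<in> carrier U" for x y
  proof -
    have "\<psi> x = \<psi> ((x \<ominus>\<^bsub>U\<^esub> y) \<oplus>\<^bsub>U\<^esub> y)"
      using xy by (simp add: a_minus_def rep.spc.M.a_assoc rep.spc.M.l_neg)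
    also have "\<dots> = \<psi> (x \<ominus>\<^bsub>U\<^esub> y) + \<psi> y" using xy by (simp add: \<psi>_add)
    finally show ?thesis by simp
  qed
  \<comment> \<open>The action in coordinates, extended to all functions through \<open>r\<close>.
    The relation \<open>r (\<psi> x) = x\<close> makes it respect brackets on the whole
    type.\<close>
  define T where "T A u = \<psi> (\<sigma> A (r u))" for A u
  have T_add: "T A (u + v) = T A u + T A v" if "A \<in> carrier sl2" for A u v
    using that by (simp add: T_def r_add \<sigma>_add r_closed \<psi>_add \<sigma>_closed)
  have T_scale: "T A (fscale c u) = fscale c (T A u)" if "A \<in> carrier sl2" for A c u
    using that by (simp add: T_def r_scale \<sigma>_scale r_closed \<psi>_scale \<sigma>_closed)
  have T_\<psi>: "T A (\<psi> x) = \<psi> (\<sigma> A x)" if "x \<in> carrier U" for A x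
    using that by (simp add: T_def r_\<psi>)
  have T_lbr: "T (lbr sl2 A A') u = T A (T A' u) - T A' (T A u)"
    if "A \<in> carrier sl2" "A' \<in> carrier sl2" for A A' u
    using that by (simp add: T_def rep.rep_lbr r_closed \<psi>_minus \<sigma>_closed r_\<psi>)
  have T_scale_left: "T (c \<odot>\<^bsub>sl2\<^esub> A) u = fscale c (T A u)" if "A \<in> carrier sl2" for A c u
    using that by (simp add: T_def \<sigma>_scale_left r_closed \<psi>_scale \<sigma>_closed)
  have T_decomp: "T A u = fscale (A $$ (0,0)) (T sl2_h u) + fscale (A $$ (0,1)) (T sl2_e u)
      + fscale (A $$ (1,0)) (T sl2_f u)" if A: "A \<in> carrier sl2" for A u
  proof -
    have closed: "c \<odot>\<^bsub>sl2\<^esub> A \<in> carrier sl2" if "A \<in> carrier sl2" for c A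
      using that by (rule rep.alg.smult_closed[rotated]) simp
    have add: "T (A \<oplus>\<^bsub>sl2\<^esub> A') u = T A u + T A' u" if "A \<in> carrier sl2" "A' \<in> carrier sl2" for A A'
      using that by (simp add: T_def \<sigma>_add_left r_closed \<psi>_add \<sigma>_closed)
    show ?thesis
      by (subst sl2_decomposition[OF A])
        (simp only: add closed sl2_basis_closed rep.alg.M.a_closed T_scale_left)
  qed
  interpret vector_space fscale by (rule vector_space_fscale)
  have lin: "Vector_Spaces.linear fscale fscale (T A)" if "A \<in> carrier sl2" for A
    by unfold_locales (simp_all add: T_add T_scale that)
  interpret tri: sl2_triple fscale "T sl2_e" "T sl2_f" "T sl2_h"
  proof
    show "T sl2_e (T sl2_f u) = T sl2_f (T sl2_e u) + T sl2_h u" for u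
      using T_lbr[OF sl2_basis_closed(1,2), of u] by (simp add: sl2_bracket_e_f)
    show "T sl2_h (T sl2_e u) = T sl2_e (T sl2_h u) + fscale 2 (T sl2_e u)" for u
      using T_lbr[OF sl2_basis_closed(3,1), of u] by (simp add: sl2_bracket_h_e T_scale_left sl2_basis_closed)
    show "T sl2_h (T sl2_f u) = T sl2_f (T sl2_h u) - fscale 2 (T sl2_f u)" for u
      using T_lbr[OF sl2_basis_closed(3,2), of u]
      by (simp add: sl2_bracket_h_f T_scale_left sl2_basis_closed fun_eq_iff algebra_simps)
  qed (simp_all add: T_add T_scale sl2_basis_closed)
  let ?D = "(\<lambda>b i. if i = b then 1 else 0 :: complex) ` B"
  have in_span: "\<psi> x \<in> span ?D" if "x \<in> carrier U" for x
    using B supp[OF that] by (rule fscale_support_in_span)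
  have "T sl2_e u \<in> span ?D" for u
    using in_span by (simp add: T_def \<sigma>_closed sl2_basis_closed r_closed)
  then obtain N where N: "\<And>u. (T sl2_e ^^ N) u = 0"
    using tri.nilpotent_of_finite_dim[of ?D] B by blast
  interpret tri: nilpotent_sl2_triple fscale "T sl2_e" "T sl2_f" "T sl2_h" N
    by unfold_locales (rule N)
  obtain ts where ts: "\<And>\<mu> n. (\<mu>, n) \<in> set ts \<Longrightarrow> tri.lowest_weight \<mu> n"
    and sep: "\<And>u. u \<in> span ?D \<Longrightarrow> \<forall>(\<mu>, n)\<in>set ts. \<forall>j. \<mu> ((T sl2_e ^^ j) u) = 0 \<Longrightarrow> u = 0"
    using tri.finite_separating_family[of ?D] B by blast
  \<comment> \<open>The pair at position \<open>k\<close> of \<open>ts\<close>, of weight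
    \<open>n\<close>, maps into the copy \<open>(n, k)\<close>; all other components are 0, so
    finitely many remain. Dividing by \<open>fact j\<close> turns the values at \<open>E^j\<close>
    into coefficients of a binary form, on which \<open>e\<close> acts by
    \<open>(j + 1) * u (j + 1)\<close>.\<close>
  define \<theta> where "\<theta> = (\<lambda>x (n, k) j. if k < length ts \<and> snd (ts ! k) = n
    then fst (ts ! k) ((T sl2_e ^^ j) (\<psi> x)) / fact j else 0 :: complex)"
  have weight: "tri.lowest_weight (fst (ts ! k)) (snd (ts ! k))" if "k < length ts" for k
    using ts[of "fst (ts ! k)" "snd (ts ! k)"] nth_mem[OF that] by simp
  then have low: "tri.lowest (fst (ts ! k))" if "k < length ts" for k
    using that by (simp add: tri.lowest_weight_def)
  have \<theta>_add: "\<theta> (x \<oplus>\<^bsub>U\<^esub> y) m j = \<theta> x m j + \<theta> y m j" if "x \<in> carrier U" "y \<in> carrier U" for x y m j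
    using that by (cases m) (auto simp: \<theta>_def \<psi>_add tri.E_pow_add tri.lowestD[OF low] add_divide_distrib)
  have \<theta>_scale: "\<theta> (c \<odot>\<^bsub>U\<^esub> x) m j = c * \<theta> x m j" if "x \<in> carrier U" for c x m j
    using that by (cases m) (auto simp: \<theta>_def \<psi>_scale tri.E_pow_scale tri.lowestD[OF low])
  have "\<theta> x \<in> carrier U_fd" if "x \<in> carrier U" for x
  proof -
    have "\<theta> x (n, k) j = 0" if "n < j" for n k j
      using tri.lowest_weight_E_pow_eq_0[OF weight] that by (auto simp: \<theta>_def)
    moreover have "{m. \<theta> x m \<noteq> (\<lambda>_. 0)} \<subseteq> (\<lambda>k. (snd (ts ! k), k)) ` {..<length ts}"
      by (auto simp: \<theta>_def fun_eq_iff split: if_splits)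
    then have "finite {m. \<theta> x m \<noteq> (\<lambda>_. 0)}" by (rule finite_subset) simp
    ultimately show ?thesis by (simp add: U_fd_def sl2_irr_def)
  qed
  then have \<theta>_lin: "\<theta> \<in> linear_maps U U_fd"
    by (simp add: LinearCombinations.module_hom_def U_fd_def \<theta>_add \<theta>_scale fun_eq_iff)
  have "inj_on \<theta> (carrier U)"
  proof
    fix x y assume xy: "x \<in> carrier U" "y \<in> carrier U" "\<theta> x = \<theta> y"
    have "\<psi> x - \<psi> y = 0"
    proof (rule sep)
      show "\<psi> x - \<psi> y \<in> span ?D" using xy in_span by (intro span_diff)
      have "\<mu> ((T sl2_e ^^ j) (\<psi> x - \<psi> y)) = 0" if "(\<mu>, n) \<in> set ts" for \<mu> n j
      proof -
        obtain k where k: "k < length ts" "ts ! k = (\<mu>, n)" using \<open>(\<mu>, n) \<in> set ts\<close> by (metis in_set_conv_nth)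
        have "\<theta> x (n, k) j = \<theta> y (n, k) j" using xy(3) by simp
        then have "\<mu> ((T sl2_e ^^ j) (\<psi> x)) = \<mu> ((T sl2_e ^^ j) (\<psi> y))" using k by (simp add: \<theta>_def)
        then show ?thesis using low[OF k(1)] k(2) by (simp add: tri.E_pow_diff tri.lowestD)
      qed
      then show "\<forall>(\<mu>, n)\<in>set ts. \<forall>j. \<mu> ((T sl2_e ^^ j) (\<psi> x - \<psi> y)) = 0" by blast
    qed
    then have "\<psi> x = \<psi> y" by simp
    then show "x = y" using r_\<psi> xy by metis
  qed
  moreover have "\<theta> (\<sigma> A x) = rho_fd A (\<theta> x)" if A: "A \<in> carrier sl2" and x: "x \<in> carrier U" for A x
  proof (intro ext, clarify)
    fix n k j
    \<comment> \<open>Trace zero turns the diagonal coefficient \<open>(n - j) A00 + j A11\<close>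
      into \<open>(n - 2 j) A00\<close>, the scalar in \<open>lowest_weight_E_pow_H\<close>.\<close>
    have A11: "A $$ (1,1) = - A $$ (0,0)"
      using A by (simp add: sl2_simps eq_neg_iff_add_eq_0 add.commute)
    show "\<theta> (\<sigma> A x) (n, k) j = rho_fd A (\<theta> x) (n, k) j"
    proof (cases "k < length ts \<and> snd (ts ! k) = n")
      case False
      then show ?thesis by (auto simp: \<theta>_def rho_fd_def sl2_irr_action_def)
    next
      case True
      define \<mu> where "\<mu> = fst (ts ! k)"
      have \<mu>: "tri.lowest_weight \<mu> n" using weight True by (auto simp: \<mu>_def)
      have lo: "tri.lowest \<mu>" using \<mu> by (simp add: tri.lowest_weight_def)
      have \<theta>: "\<theta> y (n, k) i = \<mu> ((T sl2_e ^^ i) (\<psi> y)) / fact i" for y i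
        using True by (simp add: \<theta>_def \<mu>_def)
      have "\<theta> (\<sigma> A x) (n, k) j = \<mu> ((T sl2_e ^^ j) (T A (\<psi> x))) / fact j"
        using x by (simp add: \<theta> T_\<psi>)
      also have "\<dots> = (A $$ (0,0) * \<mu> ((T sl2_e ^^ j) (T sl2_h (\<psi> x)))
          + A $$ (0,1) * \<mu> ((T sl2_e ^^ j) (T sl2_e (\<psi> x)))
          + A $$ (1,0) * \<mu> ((T sl2_e ^^ j) (T sl2_f (\<psi> x)))) / fact j"
        unfolding T_decomp[OF A] by (simp only: tri.E_pow_add tri.E_pow_scale tri.lowestD[OF lo])
      also have "\<dots> = A $$ (0,0) * (\<mu> ((T sl2_e ^^ j) (T sl2_h (\<psi> x))) / fact j)
          + A $$ (0,1) * (\<mu> ((T sl2_e ^^ j) (T sl2_e (\<psi> x))) / fact j)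
          + A $$ (1,0) * (\<mu> ((T sl2_e ^^ j) (T sl2_f (\<psi> x))) / fact j)"
        by (simp add: add_divide_distrib)
      also have "\<mu> ((T sl2_e ^^ j) (T sl2_h (\<psi> x))) / fact j = (of_nat n - 2 * of_nat j) * \<theta> x (n, k) j"
        by (simp add: \<theta> tri.lowest_weight_E_pow_H[OF \<mu>])
      also have "\<mu> ((T sl2_e ^^ j) (T sl2_e (\<psi> x))) / fact j = (of_nat j + 1) * \<theta> x (n, k) (j + 1)"
      proof -
        have "(of_nat j + 1 :: complex) \<noteq> 0" by (metis of_nat_Suc of_nat_neq_0 add.commute)
        then show ?thesis by (simp add: \<theta> funpow_swap1 add.commute)
      qed
      also have "\<mu> ((T sl2_e ^^ j) (T sl2_f (\<psi> x))) / fact j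
          = (if j = 0 then 0 else (of_nat n - of_nat j + 1) * \<theta> x (n, k) (j - 1))"
      proof (cases j)
        case 0
        then show ?thesis by (simp add: tri.lowestD[OF lo])
      next
        case (Suc i)
        \<comment> \<open>The factor \<open>Suc i\<close> of \<open>lowest_weight_E_pow_F\<close>
          cancels against the factorial and leaves \<open>n - i = n - j + 1\<close>.\<close>
        have "(of_nat (Suc i) :: complex) \<noteq> 0" by (rule of_nat_neq_0)
        then show ?thesis unfolding Suc tri.lowest_weight_E_pow_F[OF \<mu>]
          by (simp add: \<theta> del: of_nat_Suc) (simp add: algebra_simps)
      qed
      finally show ?thesis
        by (cases "j = 0") (simp_all add: rho_fd_def sl2_irr_action_def A11 algebra_simps del: One_nat_def)
    qed
  qed
  ultimately show ?thesis using \<theta>_lin by blast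
qed

section \<open>Transport to the component of degree 1\<close>

text \<open>\<open>W\<close> is the image of \<open>U\<close> under \<open>\<theta>\<close> followed
  by \<open>\<iota>1\<close>. Both maps are injective and equivariant, and \<open>\<iota>0\<close>
  is onto \<open>grade L 0\<close>, so the image is stable under all of degree 0.\<close>

lemma lie_submodule_of_embedding:
  assumes "pentad_lie_algebra g \<rho> V D B L \<iota>0 \<iota>1 \<iota>m"
    and "lie_rep g U \<sigma>"
    and \<theta>: "\<theta> \<in> linear_maps U V" "inj_on \<theta> (carrier U)"
    and equivariant: "\<forall>a\<in>carrier g. \<forall>x\<in>carrier U. \<theta> (\<sigma> a x) = \<rho> a (\<theta> x)"
  shows "\<exists>W. lie_submodule (L\<lparr>carrier := grade L 0\<rparr>) (L\<lparr>carrier := grade L 1\<rparr>) (lbr L) W \<and>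
    (\<exists>f. rep_iso g U \<sigma> (L\<lparr>carrier := W\<rparr>) (\<lambda>a. lbr L (\<iota>0 a)) f)"
proof -
  let ?L1 = "L\<lparr>carrier := grade L 1\<rparr>"
  interpret rep: lie_rep g U \<sigma> by (rule assms(2))
  interpret L: graded_lie_algebra L using assms(1) by (simp add: pentad_lie_algebra_def)
  have \<iota>0: "bij_betw \<iota>0 (carrier g) (grade L 0)"
    and \<iota>1: "\<iota>1 \<in> linear_maps V ?L1" "bij_betw \<iota>1 (carrier V) (grade L 1)"
      "\<And>a v. a \<in> carrier g \<Longrightarrow> v \<in> carrier V \<Longrightarrow> \<iota>1 (\<rho> a v) = lbr L (\<iota>0 a) (\<iota>1 v)"
    using assms(1) by (simp_all add: pentad_lie_algebra_def rep_iso_def)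
  have \<theta>_closed: "\<theta> x \<in> carrier V" if "x \<in> carrier U" for x
    using module_hom_closed[OF \<theta>(1)] that by blast
  have \<sigma>_closed: "\<sigma> a x \<in> carrier U" if "a \<in> carrier g" "x \<in> carrier U" for a x
    using rep.rep_bilinear that unfolding bilinear_map_def LinearCombinations.module_hom_def by blast
  let ?f = "\<lambda>x. \<iota>1 (\<theta> x)" and ?W = "(\<lambda>x. \<iota>1 (\<theta> x)) ` carrier U"
  have lin: "?f \<in> linear_maps U ?L1"
    using \<theta>(1) \<iota>1(1) unfolding LinearCombinations.module_hom_def by (auto simp: Pi_iff)
  have equiv: "?f (\<sigma> a x) = lbr L (\<iota>0 a) (?f x)" if "a \<in> carrier g" "x \<in> carrier U" for a x
    using equivariant \<iota>1(3) \<theta>_closed that by simp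
  interpret L1: vectorspace cfield ?L1
    using L.subspace_is_vs[OF L.grade_subspace] .
  interpret f: linear_map cfield U ?L1 ?f
    by unfold_locales (rule lin)
  have "VectorSpace.subspace cfield ?W ?L1"
    using f.imT_is_subspace unfolding f.im_def .
  moreover have "lbr L y w \<in> ?W" if yw: "y \<in> grade L 0" "w \<in> ?W" for y w
  proof -
    obtain a x where "a \<in> carrier g" "y = \<iota>0 a" "x \<in> carrier U" "w = ?f x"
      using yw \<iota>0 unfolding bij_betw_def by blast
    then show ?thesis using equiv[of a x] \<sigma>_closed[of a x] by (intro image_eqI[of _ _ "\<sigma> a x"]) simp_all
  qed
  ultimately have "lie_submodule (L\<lparr>carrier := grade L 0\<rparr>) ?L1 (lbr L) ?W"
    by (simp add: lie_submodule_def)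
  moreover have "rep_iso g U \<sigma> (L\<lparr>carrier := ?W\<rparr>) (\<lambda>a. lbr L (\<iota>0 a)) ?f"
  proof -
    have "?f \<in> linear_maps U (L\<lparr>carrier := ?W\<rparr>)"
      using lin by (auto simp: LinearCombinations.module_hom_def)
    moreover have "inj_on ?f (carrier U)"
      using \<theta>(2) \<iota>1(2) \<theta>_closed by (auto simp: inj_on_def bij_betw_def)
    ultimately show ?thesis using equiv by (simp add: rep_iso_def bij_betw_def)
  qed
  ultimately show ?thesis by blast
qed

theorem proposition3p10:
  fixes U :: "(complex, 'u) module"
    and \<sigma> :: "complex mat \<Rightarrow> 'u \<Rightarrow> 'u"
    and P :: "(nat \<times> nat \<Rightarrow> nat \<Rightarrow> complex) \<Rightarrow> (nat \<times> nat \<Rightarrow> nat \<Rightarrow> complex) \<Rightarrow> complex"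
    and L :: "'a graded_lie"
    and \<iota>0 :: "complex mat \<Rightarrow> 'a"
    and \<iota>1 :: "(nat \<times> nat \<Rightarrow> nat \<Rightarrow> complex) \<Rightarrow> 'a"
    and \<iota>m :: "((nat \<times> nat \<Rightarrow> nat \<Rightarrow> complex) \<Rightarrow> complex) \<Rightarrow> 'a"
  assumes "fd_pairing P"
    and "pentad_lie_algebra sl2 rho_fd U_fd (U_fd_dual P) (killing_form sl2) L \<iota>0 \<iota>1 \<iota>m"
    and "lie_rep sl2 U \<sigma>"
    and "vectorspace.fin_dim cfield U"
  shows "\<exists>W. lie_submodule (L\<lparr>carrier := grade L 0\<rparr>) (L\<lparr>carrier := grade L 1\<rparr>) (lbr L) W \<and>
             (\<exists>f. rep_iso sl2 U \<sigma> (L\<lparr>carrier := W\<rparr>) (\<lambda>x. lbr L (\<iota>0 x)) f)"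
proof -
  obtain \<theta> where "\<theta> \<in> linear_maps U U_fd" "inj_on \<theta> (carrier U)"
    "\<forall>A\<in>carrier sl2. \<forall>x\<in>carrier U. \<theta> (\<sigma> A x) = rho_fd A (\<theta> x)"
    using U_fd_embedding_exists[OF assms(3,4)] by blast
  then show ?thesis by (rule lie_submodule_of_embedding[OF assms(2,3)])
qed

end
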